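(* Let $H$ be a Hopf algebra and let $\mathbb G=(\{z_\xi\}_{\xi\in\Xi},<)$ be a finite PBW generating system of $H$. Let $\mathfrak d_H\colon\Xi\to\mathbb N$ be the positive map $\mathfrak d_H(\xi)=\min\{m\ge1\mid z_\xi\in H_{(m)}\}$. Assume $\mathbb G$ is $\mathfrak d_H$-minimal, $\mathfrak d_H$-triangular and $(\Delta_H,\mathfrak d_H)$-dominated. Then $$H_{(m)}=\operatorname{Span}\{z_V\mid V\in\mathcal P(\Xi,<),\ \mathfrak d_H(V)\le m\},\qquad m\ge0.$$
   Context: $\Bbbk$ is a field of characteristic zero; algebras, Hopf algebras and tensor products are over $\Bbbk$. $H_{(m)}$ ($m\ge0$) is the $m$-th layer of the coradical filtration of $H$ ($H_{(0)}$ is the coradical). An ordered family $\mathbb G=(\{z_\xi\}_{\xi\in\Xi},<)$ in $H$ is a family of elements together with a total order $<$ on $\Xi$. $\mathcal P(\Xi,<)$ is the set of non-decreasing words on $\Xi$ (including the empty word $\emptyset$), $\mathcal P_+(\Xi,<)$ the nonempty ones. For $V=\xi_1\cdots\xi_n$ put $z_V=z_{\xi_1}\cdots z_{\xi_n}$, $z_\emptyset=1$. $\mathbb G$ is a PBW generating system if $\{z_V\}_{V\in\mathcal P(\Xi,<)}$ is a basis of $H$; it is finite if $\Xi$ is finite. $U<_{\mathfrak r}V$ iff $U=W_1\eta W_3$, $V=W_2\xi W_3$ for some words $W_i$ and letters $\eta<\xi$; $U<_{\mathfrak r,\mathrm{lex}}V$ iff $U$ is a proper suffix of $V$ or $U<_{\mathfrak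 r}V$. A positive map $\mathfrak d\colon\Xi\to\mathbb N$ (all values $>0$) extends additively to words. $\mathbb G$ is: - $\mathfrak d$-minimal if $(z_\xi+H_+[\mathbb G,\xi,\mathfrak d])\cap H_{(\mathfrak d(\xi)-1)}=\emptyset$ for all $\xi\in\Xi$, where $H_+[\mathbb G,\xi,\mathfrak d]=\operatorname{Span}\{z_W\mid W\in\mathcal P_+(\Xi,<),\ \mathfrak d(W)\le\mathfrak d(\xi),\ W<_{\mathfrak r,\mathrm{lex}}\xi\}$; - $\mathfrak d$-triangular (for finite $\Xi$) if for all $\eta<\xi$: $z_\xi z_\eta\in\Bbbk^\times z_\eta z_\xi+\operatorname{Span}\{z_W\mid W\in\mathcal P_+(\Xi,<),\ \mathfrak d(W)\le\mathfrak d(\eta\xi),\ W<_{\mathfrak r,\mathrm{lex}}\eta\xi\}$; - $(\Delta_H,\mathfrak d)$-dominated if for all $\xi$: $\Delta_H(z_\xi)\in1\otimes z_\xi+z_\xi\otimes1+\operatorname{Span}\{z_P\otimes z_Q\mid P,Q\in\mathcal P_+(\Xi,<),\ \mathfrak d(PQ)\le\mathfrak d(\xi),\ P,Q<_{\mathfrak r}\xi\}$. *)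

theory Defs
  imports Complex_Main "HOL-Library.Poly_Mapping" "HOL-Library.Sublist"
begin

section \<open>Tensor powers\<close>

text \<open>
  \<open>'a \<Rightarrow>\<^sub>0 'k\<close> is the free vector space on \<open>'a\<close>. The tensor product \<open>H \<otimes> H\<close> is the free space
  on \<open>H \<times> H\<close> modulo the span of the bilinearity relations. A quotient that depends on the
  scalar multiplication of \<open>H\<close> is not a type, so its elements are cosets, that is, sets of formal
  sums.
\<close>

definition free_scale :: "'k::field \<Rightarrow> ('a \<Rightarrow>\<^sub>0 'k) \<Rightarrow> ('a \<Rightarrow>\<^sub>0 'k)"
  where "free_scale c x = Poly_Mapping.map ((*) c) x"

lemma lookup_free_scale: "Poly_Mapping.lookup (free_scale c x) a = c * Poly_Mapping.lookup x a"
  unfolding free_scale_def by transfer (simp add: when_def)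

lemma vector_space_free: "vector_space (free_scale :: 'k::field \<Rightarrow> ('a \<Rightarrow>\<^sub>0 'k) \<Rightarrow> _)"
  by unfold_locales
    (auto intro!: poly_mapping_eqI simp: lookup_free_scale lookup_add algebra_simps)

abbreviation free_span :: "('a \<Rightarrow>\<^sub>0 'k::field) set \<Rightarrow> ('a \<Rightarrow>\<^sub>0 'k) set"
  where "free_span \<equiv> module.span free_scale"

text \<open>The linear extension of a map defined on the basis of a free vector space.\<close>

definition free_lift :: "('k::field \<Rightarrow> 'v::ab_group_add \<Rightarrow> 'v) \<Rightarrow> ('a \<Rightarrow> 'v) \<Rightarrow> ('a \<Rightarrow>\<^sub>0 'k) \<Rightarrow> 'v"
  where "free_lift scale f x =
    (\<Sum>a\<in>Poly_Mapping.keys x. scale (Poly_Mapping.lookup x a) (f a))"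

abbreviation tens :: "'h \<Rightarrow> 'h \<Rightarrow> ('h \<times> 'h \<Rightarrow>\<^sub>0 'k::field)"
  where "tens a b \<equiv> Poly_Mapping.single (a, b) 1"

abbreviation tens3 :: "'h \<Rightarrow> 'h \<Rightarrow> 'h \<Rightarrow> ('h \<times> 'h \<times> 'h \<Rightarrow>\<^sub>0 'k::field)"
  where "tens3 a b c \<equiv> Poly_Mapping.single (a, b, c) 1"

definition tensor_relations ::
    "('k::field \<Rightarrow> 'h::ab_group_add \<Rightarrow> 'h) \<Rightarrow> ('h \<times> 'h \<Rightarrow>\<^sub>0 'k) set"
  where "tensor_relations scale = free_span
    ({tens (a + a') b - tens a b - tens a' b | a a' b. True} \<union>
     {tens a (b + b') - tens a b - tens a b' | a b b'. True} \<union>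
     {tens (scale r a) b - free_scale r (tens a b) | r a b. True} \<union>
     {tens a (scale r b) - free_scale r (tens a b) | r a b. True})"

definition tensor3_relations ::
    "('k::field \<Rightarrow> 'h::ab_group_add \<Rightarrow> 'h) \<Rightarrow> ('h \<times> 'h \<times> 'h \<Rightarrow>\<^sub>0 'k) set"
  where "tensor3_relations scale = free_span
    ({tens3 (a + a') b c - tens3 a b c - tens3 a' b c | a a' b c. True} \<union>
     {tens3 a (b + b') c - tens3 a b c - tens3 a b' c | a b b' c. True} \<union>
     {tens3 a b (c + c') - tens3 a b c - tens3 a b c' | a b c c'. True} \<union>
     {tens3 (scale r a) b c - free_scale r (tens3 a b c) | r a b c. True} \<union>
     {tens3 a (scale r b) c - free_scale r (tens3 a b c) | r a b c. True} \<union>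
     {tens3 a b (scale r c) - free_scale r (tens3 a b c) | r a b c. True})"

text \<open>The class in \<open>H \<otimes> H\<close> of a formal sum; \<open>H \<otimes> H\<close> itself is \<open>range (tensor_class scale)\<close>.\<close>

definition tensor_class ::
    "('k::field \<Rightarrow> 'h::ab_group_add \<Rightarrow> 'h) \<Rightarrow> ('h \<times> 'h \<Rightarrow>\<^sub>0 'k) \<Rightarrow> ('h \<times> 'h \<Rightarrow>\<^sub>0 'k) set"
  where "tensor_class scale x = {y. y - x \<in> tensor_relations scale}"

text \<open>The span in \<open>H \<otimes> H\<close> of the classes of the members of \<open>X\<close>.\<close>

definition tensor_span ::
    "('k::field \<Rightarrow> 'h::ab_group_add \<Rightarrow> 'h) \<Rightarrow> ('h \<times> 'h \<Rightarrow>\<^sub>0 'k) set \<Rightarrow> ('h \<times> 'h \<Rightarrow>\<^sub>0 'k) set set"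
  where "tensor_span scale X = tensor_class scale ` free_span X"

text \<open>The product \<open>(a \<otimes> b) (c \<otimes> d) = ac \<otimes> bd\<close> of \<open>H \<otimes> H\<close> on formal sums.\<close>

definition tens_mult ::
    "('h::ring_1 \<times> 'h \<Rightarrow>\<^sub>0 'k::field) \<Rightarrow> ('h \<times> 'h \<Rightarrow>\<^sub>0 'k) \<Rightarrow> ('h \<times> 'h \<Rightarrow>\<^sub>0 'k)"
  where "tens_mult x y =
    free_lift free_scale (\<lambda>(a, b). free_lift free_scale (\<lambda>(c, d). tens (a * c) (b * d)) y) x"


section \<open>Hopf algebras\<close>

text \<open>
  \<open>x \<in> comult h\<close> says that the formal sum \<open>x\<close> represents \<open>\<Delta>(h)\<close>. In \<open>coassoc\<close>, \<open>r\<close> is any choice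
  of representatives; the two sums represent \<open>(\<Delta> \<otimes> id) \<Delta>(h)\<close> and \<open>(id \<otimes> \<Delta>) \<Delta>(h)\<close>.
\<close>

locale coalgebra = vector_space scale
  for scale :: "'k::field \<Rightarrow> 'h::ab_group_add \<Rightarrow> 'h" +
  fixes comult :: "'h \<Rightarrow> ('h \<times> 'h \<Rightarrow>\<^sub>0 'k) set"
    and counit :: "'h \<Rightarrow> 'k"
  assumes comult_tensor: "comult h \<in> range (tensor_class scale)"
    and comult_add: "x \<in> comult g \<Longrightarrow> y \<in> comult h \<Longrightarrow> x + y \<in> comult (g + h)"
    and comult_scale: "x \<in> comult h \<Longrightarrow> free_scale c x \<in> comult (scale c h)"
    and counit_linear: "Vector_Spaces.linear scale (*) counit"
    and coassoc: "(\<And>g. r g \<in> comult g) \<Longrightarrow>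
      free_lift free_scale (\<lambda>(p, q). free_lift free_scale (\<lambda>(a, b). tens3 a b q) (r p)) (r h)
      - free_lift free_scale (\<lambda>(p, q). free_lift free_scale (\<lambda>(a, b). tens3 p a b) (r q)) (r h)
      \<in> tensor3_relations scale"
    and counit_left: "x \<in> comult h \<Longrightarrow> free_lift scale (\<lambda>(a, b). scale (counit a) b) x = h"
    and counit_right: "x \<in> comult h \<Longrightarrow> free_lift scale (\<lambda>(a, b). scale (counit b) a) x = h"

text \<open>
  The class \<open>ring_1\<close> includes \<open>0 \<noteq> 1\<close>. This excludes nothing: \<open>counit 1 = 1\<close> already forces it.
\<close>

locale hopf_algebra = coalgebra scale comult counit
  for scale :: "'k::field \<Rightarrow> 'h::ring_1 \<Rightarrow> 'h" and comult counit +
  fixes antipode :: "'h \<Rightarrow> 'h"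
  assumes scale_mult_left: "scale c g * h = scale c (g * h)"
    and scale_mult_right: "g * scale c h = scale c (g * h)"
    and comult_one: "tens 1 1 \<in> comult 1"
    and comult_mult: "x \<in> comult g \<Longrightarrow> y \<in> comult h \<Longrightarrow> tens_mult x y \<in> comult (g * h)"
    and counit_one: "counit 1 = 1"
    and counit_mult: "counit (g * h) = counit g * counit h"
    and antipode_linear: "Vector_Spaces.linear scale scale antipode"
    and antipode_left:
      "x \<in> comult h \<Longrightarrow> free_lift scale (\<lambda>(a, b). antipode a * b) x = scale (counit h) 1"
    and antipode_right:
      "x \<in> comult h \<Longrightarrow> free_lift scale (\<lambda>(a, b). a * antipode b) x = scale (counit h) 1"


section \<open>The coradical filtration\<close>

definition subcoalgebra ::
    "('k::field \<Rightarrow> 'h::ab_group_add \<Rightarrow> 'h) \<Rightarrow> ('h \<Rightarrow> ('h \<times> 'h \<Rightarrow>\<^sub>0 'k) set) \<Rightarrow> 'h set \<Rightarrow> bool"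
  where "subcoalgebra scale comult C \<longleftrightarrow>
    module.subspace scale C \<and>
    (\<forall>h\<in>C. comult h \<in> tensor_span scale {tens a b | a b. a \<in> C \<and> b \<in> C})"

definition simple_subcoalgebra ::
    "('k::field \<Rightarrow> 'h::ab_group_add \<Rightarrow> 'h) \<Rightarrow> ('h \<Rightarrow> ('h \<times> 'h \<Rightarrow>\<^sub>0 'k) set) \<Rightarrow> 'h set \<Rightarrow> bool"
  where "simple_subcoalgebra scale comult C \<longleftrightarrow>
    subcoalgebra scale comult C \<and> C \<noteq> {0} \<and>
    (\<forall>D. subcoalgebra scale comult D \<and> D \<subseteq> C \<longrightarrow> D = {0} \<or> D = C)"

definition coradical ::
    "('k::field \<Rightarrow> 'h::ab_group_add \<Rightarrow> 'h) \<Rightarrow> ('h \<Rightarrow> ('h \<times> 'h \<Rightarrow>\<^sub>0 'k) set) \<Rightarrow> 'h set"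
  where "coradical scale comult = module.span scale (\<Union>{C. simple_subcoalgebra scale comult C})"

text \<open>\<open>H\<^sub>(\<^sub>m\<^sub>+\<^sub>1\<^sub>) = \<Delta>\<^sup>-\<^sup>1(H \<otimes> H\<^sub>(\<^sub>m\<^sub>) + H\<^sub>(\<^sub>0\<^sub>) \<otimes> H)\<close>\<close>

primrec coradical_filtration ::
    "('k::field \<Rightarrow> 'h::ab_group_add \<Rightarrow> 'h) \<Rightarrow> ('h \<Rightarrow> ('h \<times> 'h \<Rightarrow>\<^sub>0 'k) set) \<Rightarrow> nat \<Rightarrow> 'h set"
  where
    "coradical_filtration scale comult 0 = coradical scale comult"
  | "coradical_filtration scale comult (Suc m) =
      {h. comult h \<in> tensor_span scale
        ({tens a b | a b. b \<in> coradical_filtration scale comult m} \<union>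
         {tens a b | a b. a \<in> coradical scale comult})}"


section \<open>Words and ordered families\<close>

text \<open>
  \<open>\<Xi>\<close> is a set in a linearly ordered type rather than a type, so that it may be empty. Only the
  values of \<open>z\<close> and \<open>d\<close> on \<open>\<Xi>\<close> matter.
\<close>

definition nondecreasing_words :: "'i::linorder set \<Rightarrow> 'i list set"
  where "nondecreasing_words \<Xi> = {V. set V \<subseteq> \<Xi> \<and> sorted V}"

definition nondecreasing_words_plus :: "'i::linorder set \<Rightarrow> 'i list set"
  where "nondecreasing_words_plus \<Xi> = nondecreasing_words \<Xi> - {[]}"

definition word_prod :: "('i \<Rightarrow> 'h::ring_1) \<Rightarrow> 'i list \<Rightarrow> 'h"
  where "word_prod z V = prod_list (map z V)"

definition word_degree :: "('i \<Rightarrow> nat) \<Rightarrow> 'i list \<Rightarrow> nat"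
  where "word_degree d V = sum_list (map d V)"

definition less_r :: "'i::linorder list \<Rightarrow> 'i list \<Rightarrow> bool"
  where "less_r U V \<longleftrightarrow>
    (\<exists>W1 W2 W3 \<eta> \<xi>. \<eta> < \<xi> \<and> U = W1 @ [\<eta>] @ W3 \<and> V = W2 @ [\<xi>] @ W3)"

definition less_rlex :: "'i::linorder list \<Rightarrow> 'i list \<Rightarrow> bool"
  where "less_rlex U V \<longleftrightarrow> strict_suffix U V \<or> less_r U V"

definition PBW_generating_system ::
    "('k::field \<Rightarrow> 'h::ring_1 \<Rightarrow> 'h) \<Rightarrow> 'i::linorder set \<Rightarrow> ('i \<Rightarrow> 'h) \<Rightarrow> bool"
  where "PBW_generating_system scale \<Xi> z \<longleftrightarrow>
    inj_on (word_prod z) (nondecreasing_words \<Xi>) \<and>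
    \<not> module.dependent scale (word_prod z ` nondecreasing_words \<Xi>) \<and>
    module.span scale (word_prod z ` nondecreasing_words \<Xi>) = UNIV"

definition H_plus ::
    "('k::field \<Rightarrow> 'h::ring_1 \<Rightarrow> 'h) \<Rightarrow> 'i::linorder set \<Rightarrow> ('i \<Rightarrow> 'h) \<Rightarrow> 'i \<Rightarrow> ('i \<Rightarrow> nat) \<Rightarrow> 'h set"
  where "H_plus scale \<Xi> z \<xi> d = module.span scale
    {word_prod z W | W. W \<in> nondecreasing_words_plus \<Xi> \<and>
      word_degree d W \<le> d \<xi> \<and> less_rlex W [\<xi>]}"

definition minimal_system ::
    "('k::field \<Rightarrow> 'h::ring_1 \<Rightarrow> 'h) \<Rightarrow> ('h \<Rightarrow> ('h \<times> 'h \<Rightarrow>\<^sub>0 'k) set) \<Rightarrow>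
     'i::linorder set \<Rightarrow> ('i \<Rightarrow> 'h) \<Rightarrow> ('i \<Rightarrow> nat) \<Rightarrow> bool"
  where "minimal_system scale comult \<Xi> z d \<longleftrightarrow>
    (\<forall>\<xi>\<in>\<Xi>. {z \<xi> + h | h. h \<in> H_plus scale \<Xi> z \<xi> d} \<inter>
       coradical_filtration scale comult (d \<xi> - 1) = {})"

definition triangular_system ::
    "('k::field \<Rightarrow> 'h::ring_1 \<Rightarrow> 'h) \<Rightarrow> 'i::linorder set \<Rightarrow> ('i \<Rightarrow> 'h) \<Rightarrow> ('i \<Rightarrow> nat) \<Rightarrow> bool"
  where "triangular_system scale \<Xi> z d \<longleftrightarrow>
    (\<forall>\<eta>\<in>\<Xi>. \<forall>\<xi>\<in>\<Xi>. \<eta> < \<xi> \<longrightarrow>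
      z \<xi> * z \<eta> \<in> {scale c (z \<eta> * z \<xi>) + h | c h. c \<noteq> 0 \<and> h \<in> module.span scale
        {word_prod z W | W. W \<in> nondecreasing_words_plus \<Xi> \<and>
          word_degree d W \<le> word_degree d [\<eta>, \<xi>] \<and> less_rlex W [\<eta>, \<xi>]}})"

definition dominated_system ::
    "('k::field \<Rightarrow> 'h::ring_1 \<Rightarrow> 'h) \<Rightarrow> ('h \<Rightarrow> ('h \<times> 'h \<Rightarrow>\<^sub>0 'k) set) \<Rightarrow>
     'i::linorder set \<Rightarrow> ('i \<Rightarrow> 'h) \<Rightarrow> ('i \<Rightarrow> nat) \<Rightarrow> bool"
  where "dominated_system scale comult \<Xi> z d \<longleftrightarrow>
    (\<forall>\<xi>\<in>\<Xi>. comult (z \<xi>) \<in>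
      {tensor_class scale (tens 1 (z \<xi>) + tens (z \<xi>) 1 + t) | t. t \<in> free_span
        {tens (word_prod z P) (word_prod z Q) | P Q.
          P \<in> nondecreasing_words_plus \<Xi> \<and> Q \<in> nondecreasing_words_plus \<Xi> \<and>
          word_degree d (P @ Q) \<le> d \<xi> \<and> less_r P [\<xi>] \<and> less_r Q [\<xi>]}})"

text \<open>
  The minimum exists: the coradical filtration of a coalgebra is exhaustive.
\<close>

definition d_H ::
    "('k::field \<Rightarrow> 'h::ring_1 \<Rightarrow> 'h) \<Rightarrow> ('h \<Rightarrow> ('h \<times> 'h \<Rightarrow>\<^sub>0 'k) set) \<Rightarrow> ('i \<Rightarrow> 'h) \<Rightarrow> 'i \<Rightarrow> nat"
  where "d_H scale comult z \<xi> = (LEAST m. 1 \<le> m \<and> z \<xi> \<in> coradical_filtration scale comult m)"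

end

theory Submission
  imports Defs "HOL-Library.Multiset_Order"
begin

text \<open>
  Write \<open>b\<^sub>M\<close> for the PBW monomial of a multiset \<open>M\<close> of letters. In the multiset order, triangularity
  straightens every word into monomials below it, and domination gives
  \<open>\<Delta>(b\<^sub>V) = \<Sum> n\<^sub>A\<^sub>B b\<^sub>A \<otimes> b\<^sub>B\<close> over \<open>A + B = V\<close> with positive integers \<open>n\<^sub>A\<^sub>B\<close>, up to terms with
  \<open>A + B < V\<close> and no larger degree. Contracting \<open>\<Delta>(h)\<close> with the coordinate of the largest monomial
  of \<open>h\<close> shows that every nonzero subcoalgebra contains 1, so the coradical is \<open>k \<cdot> 1\<close>.

  The inclusion \<open>\<supseteq>\<close> is read off from \<open>\<Delta>(b\<^sub>V)\<close>. For \<open>\<subseteq>\<close>, suppose that \<open>x \<in> H\<^sub>(\<^sub>n\<^sub>)\<close> has degree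
  \<open>N > n\<close>, and let \<open>V\<close> be its largest monomial of degree \<open>N\<close>. If \<open>V = {v} + Q\<close> with \<open>Q\<close> nonempty,
  contract the second factor of \<open>\<Delta>(x)\<close> with the coordinate of \<open>Q\<close>: by coassociativity and induction
  the result lies in a layer too low to contain \<open>v\<close>, while its coefficient at \<open>v\<close> is nonzero in
  characteristic zero. If \<open>V\<close> is a single letter, minimality is violated.
\<close>

section \<open>Free vector spaces and tensors\<close>

interpretation free: vector_space "free_scale :: 'k::field \<Rightarrow> ('a \<Rightarrow>\<^sub>0 'k) \<Rightarrow> _"
  by (rule vector_space_free)

lemma linear_image_mem_subspace:
  assumes "Vector_Spaces.linear s1 s2 f" and "module.subspace s2 W"
    and "\<And>x. x \<in> S \<Longrightarrow> f x \<in> W" and "x \<in> module.span s1 S"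
  shows "f x \<in> W"
proof -
  interpret f: Vector_Spaces.linear s1 s2 f by fact
  have "f x \<in> f.vs2.span (f ` S)"
    using assms(4) by (simp add: f.span_image)
  also have "\<dots> \<subseteq> W"
    by (rule f.vs2.span_minimal) (use assms in auto)
  finally show ?thesis .
qed

context vector_space
begin

lemma free_lift_eq_sum:
  assumes "finite S" and "Poly_Mapping.keys x \<subseteq> S"
  shows "free_lift scale f x = (\<Sum>a\<in>S. scale (Poly_Mapping.lookup x a) (f a))"
  unfolding free_lift_def
  by (rule sum.mono_neutral_left) (use assms in \<open>auto simp: in_keys_iff\<close>)

lemma free_lift_add: "free_lift scale f (x + y) = free_lift scale f x + free_lift scale f y"
proof -
  let ?S = "Poly_Mapping.keys x \<union> Poly_Mapping.keys y"
  have "Poly_Mapping.keys (x + y) \<subseteq> ?S" by (rule Poly_Mapping.keys_add)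
  then show ?thesis
    by (simp add: free_lift_eq_sum[where S = ?S] lookup_add scale_left_distrib sum.distrib)
qed

lemma free_lift_free_scale: "free_lift scale f (free_scale c x) = scale c (free_lift scale f x)"
proof -
  have "Poly_Mapping.keys (free_scale c x) \<subseteq> Poly_Mapping.keys x"
    by (auto simp: in_keys_iff lookup_free_scale)
  then show ?thesis
    by (simp add: free_lift_eq_sum[where S = "Poly_Mapping.keys x"] lookup_free_scale
        scale_sum_right)
qed

lemma linear_free_lift: "Vector_Spaces.linear free_scale scale (free_lift scale f)"
  by unfold_locales (simp_all add: free_lift_add free_lift_free_scale)

lemma free_lift_single [simp]: "free_lift scale f (Poly_Mapping.single a c) = scale c (f a)"
  by (subst free_lift_eq_sum[where S = "{a}"]) auto

lemma free_lift_diff_fun: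
  "free_lift scale (\<lambda>a. f a - g a) x = free_lift scale f x - free_lift scale g x"
  by (simp add: free_lift_def scale_right_diff_distrib sum_subtractf)

lemma free_lift_add_fun:
  "free_lift scale (\<lambda>a. f a + g a) x = free_lift scale f x + free_lift scale g x"
  by (simp add: free_lift_def scale_right_distrib sum.distrib)

lemma free_lift_mem_subspace:
  assumes "subspace W" and "\<And>a. a \<in> Poly_Mapping.keys x \<Longrightarrow> f a \<in> W"
  shows "free_lift scale f x \<in> W"
  unfolding free_lift_def by (intro subspace_sum subspace_scale assms)

end

lemma linear_free_lift_apply:
  assumes "Vector_Spaces.linear s1 s2 T"
  shows "T (free_lift s1 f x) = free_lift s2 (\<lambda>a. T (f a)) x"
proof -
  interpret T: Vector_Spaces.linear s1 s2 T by fact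
  show ?thesis by (simp add: free_lift_def T.sum T.scale)
qed

lemma free_lift_tens [simp]: "free_lift free_scale (\<lambda>a. Poly_Mapping.single a 1) x = x"
proof -
  have "Poly_Mapping.lookup (free_lift free_scale (\<lambda>a. Poly_Mapping.single a 1) x) b =
      Poly_Mapping.lookup x b" for b
    by (cases "b \<in> Poly_Mapping.keys x")
      (auto simp: free_lift_def lookup_sum lookup_free_scale lookup_single when_def
        in_keys_iff if_distrib[of "(*) _"] cong: if_cong)
  then show ?thesis by (rule poly_mapping_eqI)
qed

lemma linear_sum_list:
  assumes "Vector_Spaces.linear s1 s2 f"
  shows "f (sum_list xs) = sum_list (map f xs)"
proof -
  interpret Vector_Spaces.linear s1 s2 f by fact
  show ?thesis by (induction xs) (simp_all add: zero add)
qed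

lemma subspace_sum_list:
  assumes "free.subspace W" and "set xs \<subseteq> W"
  shows "sum_list xs \<in> W"
  using assms(2) by (induction xs) (auto intro: free.subspace_0 free.subspace_add assms(1))

section \<open>The bilinearity relations and the subspaces that contain them\<close>

lemma subspace_tensor_relations: "free.subspace (tensor_relations scale)"
  unfolding tensor_relations_def by (rule free.subspace_span)

lemma tensor_relations_add_left:
  "tens (a + a') b - tens a b - tens a' b \<in> tensor_relations scale"
  unfolding tensor_relations_def by (rule free.span_base) blast

lemma tensor_relations_add_right:
  "tens a (b + b') - tens a b - tens a b' \<in> tensor_relations scale"
  unfolding tensor_relations_def by (rule free.span_base) blast

lemma tensor_relations_scale_left:
  "tens (scale r a) b - free_scale r (tens a b) \<in> tensor_relations scale"
  unfolding tensor_relations_def by (rule free.span_base) blast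

lemma tensor_relations_scale_right:
  "tens a (scale r b) - free_scale r (tens a b) \<in> tensor_relations scale"
  unfolding tensor_relations_def by (rule free.span_base) blast

lemmas tensor_relations_generators =
  tensor_relations_add_left tensor_relations_add_right
  tensor_relations_scale_left tensor_relations_scale_right

text \<open>Universal property of the tensor product, with values in the quotient by
  \<open>W\<close>. For \<open>W = {0}\<close> it makes contractions well defined; the triple
  version is applied with the relations of H \<otimes> H as \<open>W\<close>.\<close>

lemma linear_tensor_relations_mem:
  assumes F: "Vector_Spaces.linear free_scale s F" and W: "module.subspace s W"
    and "\<And>a a' b. F (tens (a + a') b) - F (tens a b) - F (tens a' b) \<in> W"
    and "\<And>a b b'. F (tens a (b + b')) - F (tens a b) - F (tens a b') \<in> W"
    and "\<And>r a b. F (tens (scale r a) b) - s r (F (tens a b)) \<in> W"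
    and "\<And>r a b. F (tens a (scale r b)) - s r (F (tens a b)) \<in> W"
    and "x \<in> tensor_relations scale"
  shows "F x \<in> W"
proof -
  interpret F: Vector_Spaces.linear free_scale s F by fact
  show ?thesis
    by (rule linear_image_mem_subspace[OF F W _ assms(7)[unfolded tensor_relations_def]])
      (use assms(3-6) in \<open>auto simp: F.diff F.scale\<close>)
qed

lemma linear_tensor3_relations_mem:
  assumes F: "Vector_Spaces.linear free_scale s F" and W: "module.subspace s W"
    and "\<And>a a' b c. F (tens3 (a + a') b c) - F (tens3 a b c) - F (tens3 a' b c) \<in> W"
    and "\<And>a b b' c. F (tens3 a (b + b') c) - F (tens3 a b c) - F (tens3 a b' c) \<in> W"
    and "\<And>a b c c'. F (tens3 a b (c + c')) - F (tens3 a b c) - F (tens3 a b c') \<in> W"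
    and "\<And>r a b c. F (tens3 (scale r a) b c) - s r (F (tens3 a b c)) \<in> W"
    and "\<And>r a b c. F (tens3 a (scale r b) c) - s r (F (tens3 a b c)) \<in> W"
    and "\<And>r a b c. F (tens3 a b (scale r c)) - s r (F (tens3 a b c)) \<in> W"
    and "x \<in> tensor3_relations scale"
  shows "F x \<in> W"
proof -
  interpret F: Vector_Spaces.linear free_scale s F by fact
  show ?thesis
    by (rule linear_image_mem_subspace[OF F W _ assms(9)[unfolded tensor3_relations_def]])
      (use assms(3-8) in \<open>auto simp: F.diff F.scale\<close>)
qed

lemma tens_zero_left: "tens 0 b \<in> tensor_relations scale"
  using tensor_relations_add_left[of 0 0 b scale]
    free.subspace_neg[OF subspace_tensor_relations] by fastforce

lemma tens_zero_right: "tens a 0 \<in> tensor_relations scale"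
  using tensor_relations_add_right[of a 0 0 scale]
    free.subspace_neg[OF subspace_tensor_relations] by fastforce

context vector_space
begin

text \<open>\<open>R\<close> stands for the preimage in formal sums of a subspace of H \<otimes> H.
  Since it contains the relations, the \<open>a\<close> with \<open>tens a b\<close> in
  \<open>R\<close> form a subspace.\<close>

lemma tens_span_left:
  assumes "a \<in> span X" and R: "free.subspace R" "tensor_relations scale \<subseteq> R"
    and "\<And>x. x \<in> X \<Longrightarrow> tens x b \<in> R"
  shows "tens a b \<in> R"
  using assms(1)
proof (induction rule: span_induct_alt)
  case base
  then show ?case using tens_zero_left R by blast
next
  case (step c x y)
  have "tens (scale c x + y) b - tens (scale c x) b - tens y b \<in> R"
    using tensor_relations_add_left R by blast
  moreover have "tens (scale c x) b - free_scale c (tens x b) \<in> R"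
    using tensor_relations_scale_left R by blast
  moreover have "free_scale c (tens x b) \<in> R"
    using assms(4)[OF step(1)] R(1) by (rule free.subspace_scale[rotated])
  ultimately have "(tens (scale c x + y) b - tens (scale c x) b - tens y b) +
    ((tens (scale c x) b - free_scale c (tens x b)) + free_scale c (tens x b)) + tens y b \<in> R"
    using step(2) by (intro free.subspace_add[OF R(1)])
  then show ?case by simp
qed

lemma tens_span_right:
  assumes "b \<in> span X" and R: "free.subspace R" "tensor_relations scale \<subseteq> R"
    and "\<And>x. x \<in> X \<Longrightarrow> tens a x \<in> R"
  shows "tens a b \<in> R"
  using assms(1)
proof (induction rule: span_induct_alt)
  case base
  then show ?case using tens_zero_right R by blast
next
  case (step c x y)
  have "tens a (scale c x + y) - tens a (scale c x) - tens a y \<in> R"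
    using tensor_relations_add_right R by blast
  moreover have "tens a (scale c x) - free_scale c (tens a x) \<in> R"
    using tensor_relations_scale_right R by blast
  moreover have "free_scale c (tens a x) \<in> R"
    using assms(4)[OF step(1)] R(1) by (rule free.subspace_scale[rotated])
  ultimately have "(tens a (scale c x + y) - tens a (scale c x) - tens a y) +
    ((tens a (scale c x) - free_scale c (tens a x)) + free_scale c (tens a x)) + tens a y \<in> R"
    using step(2) by (intro free.subspace_add[OF R(1)])
  then show ?case by simp
qed

text \<open>\<open>tens p\<close> is linear only modulo the relations, hence a difference instead of
  an equation.\<close>

lemma tens_free_lift_right:
  "tens p (free_lift scale u x) - free_lift free_scale (\<lambda>a. tens p (u a)) x \<in> tensor_relations scale"
proof -
  let ?R = "tensor_relations scale"
  have "tens p (\<Sum>a\<in>S. scale (c a) (u a)) - (\<Sum>a\<in>S. free_scale (c a) (tens p (u a))) \<in> ?R"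
    if "finite S" for S and c :: "_ \<Rightarrow> 'a"
    using that
  proof (induction S rule: finite_induct)
    case empty
    then show ?case by (simp add: tens_zero_right)
  next
    case (insert s S)
    let ?v = "\<Sum>a\<in>S. scale (c a) (u a)" and ?w = "\<Sum>a\<in>S. free_scale (c a) (tens p (u a))"
    have "(tens p (scale (c s) (u s) + ?v) - tens p (scale (c s) (u s)) - tens p ?v)
        + (tens p (scale (c s) (u s)) - free_scale (c s) (tens p (u s))) + (tens p ?v - ?w) \<in> ?R"
      by (intro free.subspace_add[OF subspace_tensor_relations] tensor_relations_generators
          insert.IH)
    with insert show ?case by (simp add: algebra_simps)
  qed
  then show ?thesis by (simp add: free_lift_def)
qed

end

section \<open>Coalgebras\<close>

context coalgebra
begin

lemma comult_nonempty: "\<exists>x. x \<in> comult h"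
proof -
  obtain x where "comult h = tensor_class scale x" using comult_tensor by blast
  moreover have "x \<in> tensor_class scale x"
    by (simp add: tensor_class_def free.subspace_0[OF subspace_tensor_relations])
  ultimately show ?thesis by blast
qed

lemma mem_tensor_class_eq:
  assumes "x \<in> tensor_class scale y"
  shows "tensor_class scale x = tensor_class scale y"
proof -
  have "x - y \<in> tensor_relations scale" using assms by (simp add: tensor_class_def)
  then have "w - x \<in> tensor_relations scale \<longleftrightarrow> w - y \<in> tensor_relations scale" for w
    using free.subspace_add[OF subspace_tensor_relations, of "w - x" scale "x - y"]
      free.subspace_diff[OF subspace_tensor_relations, of "w - y" scale "x - y"] by auto
  then show ?thesis by (auto simp: tensor_class_def)
qed

lemma comult_eq_tensor_class: "x \<in> comult h \<Longrightarrow> comult h = tensor_class scale x"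
  using comult_tensor mem_tensor_class_eq by (metis imageE)

lemma mem_comult_iff: "x \<in> comult h \<Longrightarrow> y \<in> comult h \<longleftrightarrow> y - x \<in> tensor_relations scale"
  using comult_eq_tensor_class[of x h] by (simp add: tensor_class_def)

text \<open>Putting the relations into the spanning set makes the criterion independent of the
  representative \<open>x\<close>.\<close>

lemma comult_tensor_span_iff:
  assumes "x \<in> comult h"
  shows "comult h \<in> tensor_span scale X \<longleftrightarrow> x \<in> free_span (X \<union> tensor_relations scale)"
proof
  assume "comult h \<in> tensor_span scale X"
  then obtain y where y: "y \<in> free_span X" "comult h = tensor_class scale y"
    by (auto simp: tensor_span_def)
  with assms have "x - y \<in> tensor_relations scale" by (simp add: tensor_class_def)
  then have "(x - y) + y \<in> free_span (X \<union> tensor_relations scale)"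
    using y by (intro free.span_add) (auto intro: free.span_base free.span_mono[THEN subsetD])
  then show "x \<in> free_span (X \<union> tensor_relations scale)" by simp
next
  assume "x \<in> free_span (X \<union> tensor_relations scale)"
  then obtain y w where y: "y \<in> free_span X" and w: "w \<in> free_span (tensor_relations scale)"
    and x: "x = y + w" by (auto simp: free.span_Un)
  from w have "w \<in> tensor_relations scale"
    using free.span_subspace[OF subset_refl free.span_superset] free.span_eq_iff
      subspace_tensor_relations by blast
  then have "x \<in> tensor_class scale y" by (simp add: tensor_class_def x)
  then have "comult h = tensor_class scale y"
    using comult_eq_tensor_class[OF assms] mem_tensor_class_eq by simp
  then show "comult h \<in> tensor_span scale X" using y by (auto simp: tensor_span_def)
qed

lemma comult_mem_tensor_spanI:
  "x \<in> comult h \<Longrightarrow> x \<in> free_span X \<Longrightarrow> comult h \<in> tensor_span scale X"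
  by (auto simp: tensor_span_def comult_eq_tensor_class)

lemma comult_mem_tensor_spanE:
  assumes "comult h \<in> tensor_span scale X"
  obtains x where "x \<in> comult h" and "x \<in> free_span X"
proof -
  obtain y where "y \<in> free_span X" "comult h = tensor_class scale y"
    using assms by (auto simp: tensor_span_def)
  moreover have "y \<in> tensor_class scale y"
    by (simp add: tensor_class_def free.subspace_0[OF subspace_tensor_relations])
  ultimately show thesis using that by blast
qed

lemma comult_free_lift:
  assumes "\<And>a. f a \<in> comult (u a)"
  shows "free_lift free_scale f x \<in> comult (free_lift scale u x)"
proof -
  obtain w where "w \<in> comult 0" using comult_nonempty by blast
  \<comment> \<open>Linearity of \<open>comult\<close> is given on representatives, so 0 is reached
    by scaling some representative by 0.\<close>
  from comult_scale[OF this, of 0] have "0 \<in> comult 0" by simp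
  have "(\<Sum>a\<in>S. free_scale (c a) (f a)) \<in> comult (\<Sum>a\<in>S. scale (c a) (u a))"
    if "finite S" for S and c :: "_ \<Rightarrow> 'k"
    using that
    by (induction S rule: finite_induct) (auto intro!: comult_add comult_scale assms \<open>0 \<in> comult 0\<close>)
  then show ?thesis by (simp add: free_lift_def)
qed

section \<open>Contraction of the coproduct with a linear functional\<close>

text \<open>\<open>act g = (id \<otimes> g) \<circ> \<Delta>\<close> for a linear functional \<open>g\<close>.\<close>

definition act :: "('h \<Rightarrow> 'k) \<Rightarrow> 'h \<Rightarrow> 'h"
  where "act g h = free_lift scale (\<lambda>(a, b). scale (g b) a) (SOME x. x \<in> comult h)"

text \<open>Bilinearity of (a, b) \<mapsto> g(b) a. This makes the choice inside \<open>act\<close>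
  immaterial.\<close>

lemma contract_tensor_relations:
  assumes "Vector_Spaces.linear scale (*) g" and "x \<in> tensor_relations scale"
  shows "free_lift scale (\<lambda>(a, b). scale (g b) a) x = 0"
proof -
  interpret g: Vector_Spaces.linear scale "(*)" g by fact
  have "free_lift scale (\<lambda>(a, b). scale (g b) a) x \<in> {0}"
    by (rule linear_tensor_relations_mem[OF linear_free_lift _ _ _ _ _ assms(2)])
      (auto simp: g.add g.scale scale_left_distrib scale_right_distrib mult.commute)
  then show ?thesis by simp
qed

lemma act_eq:
  assumes g: "Vector_Spaces.linear scale (*) g" and x: "x \<in> comult h"
  shows "act g h = free_lift scale (\<lambda>(a, b). scale (g b) a) x"
proof -
  interpret F: Vector_Spaces.linear free_scale scale "free_lift scale (\<lambda>(a, b). scale (g b) a)"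
    by (rule linear_free_lift)
  have "(SOME x. x \<in> comult h) \<in> comult h" using x by (rule someI)
  then have "(SOME x. x \<in> comult h) - x \<in> tensor_relations scale"
    using mem_comult_iff[OF x] by simp
  from contract_tensor_relations[OF g this] show ?thesis by (simp add: act_def F.diff)
qed

lemma linear_act:
  assumes g: "Vector_Spaces.linear scale (*) g"
  shows "Vector_Spaces.linear scale scale (act g)"
proof (unfold_locales)
  interpret F: Vector_Spaces.linear free_scale scale "free_lift scale (\<lambda>(a, b). scale (g b) a)"
    by (rule linear_free_lift)
  show "act g (x + y) = act g x + act g y" for x y
  proof -
    obtain u v where "u \<in> comult x" "v \<in> comult y" using comult_nonempty by metis
    then show ?thesis by (simp add: act_eq[OF g] act_eq[OF g comult_add] F.add)
  qed
  show "act g (scale c x) = scale c (act g x)" for c x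
  proof -
    obtain u where "u \<in> comult x" using comult_nonempty by metis
    then show ?thesis by (simp add: act_eq[OF g] act_eq[OF g comult_scale] F.scale)
  qed
qed

text \<open>Coassociativity in the form \<open>\<Delta> \<circ> act g = (id \<otimes> act g) \<circ> \<Delta>\<close>.\<close>

lemma comult_act:
  assumes g: "Vector_Spaces.linear scale (*) g" and y: "y \<in> comult h"
  shows "free_lift free_scale (\<lambda>(p, q). tens p (act g q)) y \<in> comult (act g h)"
proof -
  interpret g: Vector_Spaces.linear scale "(*)" g by fact
  let ?R = "tensor_relations scale"
  \<comment> \<open>\<open>coassoc\<close> asks for a representative of every element; the choice is
    altered at \<open>h\<close> so that the outer sum is \<open>y\<close>.\<close>
  define r where "r = (\<lambda>u. SOME x. x \<in> comult u)(h := y)"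
  have r: "r u \<in> comult u" for u
    using y someI_ex[OF comult_nonempty] by (auto simp: r_def)
  \<comment> \<open>\<open>G\<close> is id \<otimes> id \<otimes> g on formal sums;
    \<open>G_rel\<close> shows that it descends to tensors.\<close>
  define G where "G = free_lift free_scale (\<lambda>(a, b, c). free_scale (g c) (tens a b :: 'h \<times> 'h \<Rightarrow>\<^sub>0 'k))"
  have G: "Vector_Spaces.linear free_scale free_scale G"
    unfolding G_def by (rule free.linear_free_lift)
  interpret G: Vector_Spaces.linear free_scale free_scale G by (rule G)
  have G_tens3: "G (tens3 a b c) = free_scale (g c) (tens a b)" for a b c
    by (simp add: G_def)
  have G_tens3': "G (Poly_Mapping.single (a, bc) 1) = free_scale (g (snd bc)) (tens a (fst bc))"
    for a bc
    by (cases bc) (simp add: G_tens3)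
  have G_rel: "G x \<in> ?R" if "x \<in> tensor3_relations scale" for x
  proof (rule linear_tensor3_relations_mem[OF G subspace_tensor_relations _ _ _ _ _ _ that],
      goal_cases)
    case (1 a a' b c)
    have "free_scale (g c) (tens (a + a') b - tens a b - tens a' b) \<in> ?R"
      by (intro free.subspace_scale[OF subspace_tensor_relations] tensor_relations_generators)
    then show ?case by (simp add: G_tens3 free.scale_right_diff_distrib)
  next
    case (2 a b b' c)
    have "free_scale (g c) (tens a (b + b') - tens a b - tens a b') \<in> ?R"
      by (intro free.subspace_scale[OF subspace_tensor_relations] tensor_relations_generators)
    then show ?case by (simp add: G_tens3 free.scale_right_diff_distrib)
  next
    case (3 a b c c')
    then show ?case
      by (simp add: G_tens3 g.add free.scale_left_distrib free.subspace_0[OF subspace_tensor_relations])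
  next
    case (4 s a b c)
    have "free_scale (g c) (tens (scale s a) b - free_scale s (tens a b)) \<in> ?R"
      by (intro free.subspace_scale[OF subspace_tensor_relations] tensor_relations_generators)
    then show ?case by (simp add: G_tens3 free.scale_right_diff_distrib mult.commute)
  next
    case (5 s a b c)
    have "free_scale (g c) (tens a (scale s b) - free_scale s (tens a b)) \<in> ?R"
      by (intro free.subspace_scale[OF subspace_tensor_relations] tensor_relations_generators)
    then show ?case by (simp add: G_tens3 free.scale_right_diff_distrib mult.commute)
  next
    case (6 s a b c)
    then show ?case
      by (simp add: G_tens3 g.scale free.subspace_0[OF subspace_tensor_relations])
  qed
  let ?X1 = "free_lift free_scale (\<lambda>(p, q). free_lift free_scale (\<lambda>(a, b). tens3 a b q) (r p)) (r h)"
  let ?X2 = "free_lift free_scale (\<lambda>(p, q). free_lift free_scale (\<lambda>(a, b). tens3 p a b) (r q)) (r h)"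
  have rh: "r h = y" by (simp add: r_def)
  have "?X1 - ?X2 \<in> tensor3_relations scale" using r by (rule coassoc)
  then have 1: "G ?X1 - G ?X2 \<in> ?R" using G_rel by (simp flip: G.diff)
  \<comment> \<open>Contracting the last factor of (\<Delta> \<otimes> id) \<Delta>(h) leaves
    \<Delta> applied to the contraction \<open>act g h\<close>.\<close>
  have "G ?X1 = free_lift free_scale (\<lambda>(p, q). free_scale (g q) (r p)) y"
  proof -
    have "G (free_lift free_scale (\<lambda>(a, b). tens3 a b q) (r p)) = free_scale (g q) (r p)" for p q
    proof -
      have "G (free_lift free_scale (\<lambda>(a, b). tens3 a b q) (r p)) =
          free_lift free_scale (\<lambda>ab. free_scale (g q) (Poly_Mapping.single ab 1)) (r p)"
        by (simp add: linear_free_lift_apply[OF G] case_prod_unfold G_tens3)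
      also have "\<dots> = free_scale (g q) (r p)"
        by (simp flip: linear_free_lift_apply[OF free.linear_scale_self])
      finally show ?thesis .
    qed
    then show ?thesis by (simp add: linear_free_lift_apply[OF G] case_prod_unfold rh)
  qed
  also have "\<dots> \<in> comult (free_lift scale (\<lambda>(p, q). scale (g q) p) y)"
    by (rule comult_free_lift) (auto intro: comult_scale r)
  also have "free_lift scale (\<lambda>(p, q). scale (g q) p) y = act g h" by (rule act_eq[OF g y, symmetric])
  finally have 2: "G ?X1 \<in> comult (act g h)" .
  \<comment> \<open>In (id \<otimes> \<Delta>) \<Delta>(h) the contraction acts inside the second
    factor and produces \<open>act g q\<close>, up to relations, because sums and scalars have to be
    moved across the tensor sign.\<close>
  have "free_lift free_scale (\<lambda>(p, q). tens p (act g q)) y - G ?X2 =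
      free_lift free_scale (\<lambda>(p, q). tens p (act g q) -
        free_lift free_scale (\<lambda>(a, b). free_scale (g b) (tens p a)) (r q)) y"
    by (simp add: linear_free_lift_apply[OF G] split_def G_tens3' rh free.free_lift_diff_fun)
  also have "\<dots> \<in> ?R"
  proof (rule free.free_lift_mem_subspace[OF subspace_tensor_relations], clarify)
    fix p q
    have "tens p (free_lift scale (\<lambda>(a, b). scale (g b) a) (r q)) -
      free_lift free_scale (\<lambda>ab. tens p (case ab of (a, b) \<Rightarrow> scale (g b) a)) (r q) \<in> ?R"
      (is "?a - ?b \<in> _")
      by (rule tens_free_lift_right)
    moreover have "?b - free_lift free_scale (\<lambda>(a, b). free_scale (g b) (tens p a)) (r q) \<in> ?R"
      unfolding free.free_lift_diff_fun[symmetric]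
      by (rule free.free_lift_mem_subspace[OF subspace_tensor_relations])
        (auto intro: tensor_relations_generators)
    ultimately have "(?a - ?b) + (?b - free_lift free_scale (\<lambda>(a, b). free_scale (g b) (tens p a)) (r q)) \<in> ?R"
      by (rule free.subspace_add[OF subspace_tensor_relations])
    then show "tens p (act g q) - free_lift free_scale (\<lambda>(a, b). free_scale (g b) (tens p a)) (r q) \<in> ?R"
      by (simp add: act_eq[OF g r])
  qed
  finally have "(free_lift free_scale (\<lambda>(p, q). tens p (act g q)) y - G ?X2) - (G ?X1 - G ?X2) \<in> ?R"
    using 1 by (rule free.subspace_diff[OF subspace_tensor_relations])
  then show ?thesis by (simp add: mem_comult_iff[OF 2])
qed

section \<open>The coradical filtration under contraction\<close>

abbreviation filtration :: "nat \<Rightarrow> 'h set"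
  where "filtration \<equiv> coradical_filtration scale comult"

abbreviation layer_tensors :: "nat \<Rightarrow> ('h \<times> 'h \<Rightarrow>\<^sub>0 'k) set"
  where "layer_tensors m \<equiv> {tens a b | a b. b \<in> filtration m} \<union>
    {tens a b | a b. a \<in> coradical scale comult}"

lemma subspace_coradical: "subspace (coradical scale comult)"
  by (simp add: coradical_def)

lemma mem_filtration_Suc_iff:
  "x \<in> comult h \<Longrightarrow>
    h \<in> filtration (Suc m) \<longleftrightarrow> x \<in> free_span (layer_tensors m \<union> tensor_relations scale)"
  by (simp add: comult_tensor_span_iff)

lemma subspace_filtration: "subspace (filtration m)"
proof (cases m)
  case 0
  then show ?thesis by (simp add: subspace_coradical)
next
  case (Suc n)
  let ?Y = "free_span (layer_tensors n \<union> tensor_relations scale)"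
  show ?thesis unfolding Suc
  proof (rule subspaceI)
    obtain u where u: "u \<in> comult 0" using comult_nonempty by blast
    have "0 \<in> comult 0" using comult_scale[OF u, of 0] by simp
    from mem_filtration_Suc_iff[OF this] show "0 \<in> filtration (Suc n)"
      by (simp only: free.span_zero)
  next
    fix x y assume xy: "x \<in> filtration (Suc n)" "y \<in> filtration (Suc n)"
    obtain u where u: "u \<in> comult x" using comult_nonempty by blast
    obtain v where v: "v \<in> comult y" using comult_nonempty by blast
    have "u \<in> ?Y" "v \<in> ?Y"
      using xy by (simp_all only: mem_filtration_Suc_iff[OF u] mem_filtration_Suc_iff[OF v])
    then show "x + y \<in> filtration (Suc n)"
      by (simp only: mem_filtration_Suc_iff[OF comult_add[OF u v]] free.span_add)
  next
    fix c x assume x: "x \<in> filtration (Suc n)"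
    obtain u where u: "u \<in> comult x" using comult_nonempty by blast
    have "u \<in> ?Y" using x by (simp only: mem_filtration_Suc_iff[OF u])
    then show "scale c x \<in> filtration (Suc n)"
      by (simp only: mem_filtration_Suc_iff[OF comult_scale[OF u]] free.span_scale)
  qed
qed

text \<open>All first factors of \<Delta>(h) may be taken in \<open>C\<close>, and contraction only
  combines them linearly.\<close>

lemma act_mem_subcoalgebra:
  assumes g: "Vector_Spaces.linear scale (*) g" and C: "subcoalgebra scale comult C"
    and h: "h \<in> C"
  shows "act g h \<in> C"
proof -
  have "comult h \<in> tensor_span scale {tens a b | a b. a \<in> C \<and> b \<in> C}"
    using C h by (simp add: subcoalgebra_def)
  then obtain x where x: "x \<in> comult h" "x \<in> free_span {tens a b | a b. a \<in> C \<and> b \<in> C}"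
    by (rule comult_mem_tensor_spanE)
  have C': "subspace C" using C by (simp add: subcoalgebra_def)
  show ?thesis
    unfolding act_eq[OF g x(1)]
    by (rule linear_image_mem_subspace[OF linear_free_lift C' _ x(2)])
      (auto intro: subspace_scale[OF C'])
qed

text \<open>A functional that vanishes on layer q lowers the layer by q + 1. For m = 0 it kills the
  terms with second factor in layer q and leaves those with first factor in the coradical. The
  induction step applies the hypothesis to the second factors, through \<Delta> \<circ> act g = (id
  \<otimes> act g) \<circ> \<Delta>.\<close>

lemma act_mem_filtration:
  assumes g: "Vector_Spaces.linear scale (*) g" and "\<And>h. h \<in> filtration q \<Longrightarrow> g h = 0"
    and "x \<in> filtration (Suc q + m)"
  shows "act g x \<in> filtration m"
  using assms(3)
proof (induction m arbitrary: x)
  case 0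
  then have "comult x \<in> tensor_span scale (layer_tensors q)" by simp
  then obtain y where y: "y \<in> comult x" "y \<in> free_span (layer_tensors q)"
    by (rule comult_mem_tensor_spanE)
  have "act g x \<in> coradical scale comult"
    unfolding act_eq[OF g y(1)]
    by (rule linear_image_mem_subspace[OF linear_free_lift subspace_coradical _ y(2)])
      (auto simp: assms(2) subspace_0[OF subspace_coradical]
        intro: subspace_scale[OF subspace_coradical])
  then show ?case by simp
next
  case (Suc m)
  then have "comult x \<in> tensor_span scale (layer_tensors (Suc q + m))" by simp
  then obtain y where y: "y \<in> comult x" "y \<in> free_span (layer_tensors (Suc q + m))"
    by (rule comult_mem_tensor_spanE)
  have "free_lift free_scale (\<lambda>(a, b). tens a (act g b)) y \<in> free_span (layer_tensors m)"
  proof (rule linear_image_mem_subspace[OF free.linear_free_lift free.subspace_span _ y(2)])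
    fix t :: "'h \<times> 'h \<Rightarrow>\<^sub>0 'k" assume "t \<in> layer_tensors (Suc q + m)"
    then obtain a b where "t = tens a b"
      and "b \<in> filtration (Suc q + m) \<or> a \<in> coradical scale comult" by blast
    then have "act g b \<in> filtration m \<or> a \<in> coradical scale comult"
      using Suc.IH by blast
    then have "tens a (act g b) \<in> layer_tensors m" by blast
    then show "free_lift free_scale (\<lambda>(a, b). tens a (act g b)) t \<in> free_span (layer_tensors m)"
      by (simp add: \<open>t = _\<close> free.span_base)
  qed
  with comult_act[OF g y(1)] have "comult (act g x) \<in> tensor_span scale (layer_tensors m)"
    by (rule comult_mem_tensor_spanI)
  then show ?case by simp
qed

end

section \<open>Words and multisets\<close>

text \<open>Insertion sort run backwards, one adjacent inversion at a time. The prefix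
  \<open>X\<close> is generalised so that swaps in the middle of a word are reachable.\<close>

lemma sort_by_swaps:
  assumes swap: "\<And>X x y Y. y < x \<Longrightarrow> P (X @ y # x # Y) \<Longrightarrow> P (X @ x # y # Y)"
    and "P (sort A)"
  shows "P A"
proof -
  have insert: "P (X @ insort x Y) \<Longrightarrow> P (X @ x # Y)" for X x Y
  proof (induction Y arbitrary: X)
    case (Cons y Y)
    show ?case
    proof (cases "x \<le> y")
      case False
      then show ?thesis using Cons.IH[of "X @ [y]"] Cons.prems swap[of y x X Y] by simp
    qed (use Cons.prems in simp)
  qed simp
  have "P (X @ sort A) \<Longrightarrow> P (X @ A)" for X
  proof (induction A arbitrary: X)
    case (Cons x A)
    then show ?case using insert[of X x "sort A"] Cons.IH[of "X @ [x]"] by simp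
  qed simp
  from this[of "[]"] assms(2) show ?thesis by simp
qed

text \<open>Against a one-letter word the comparison takes place at the last letter of
  \<open>P\<close>, which bounds all letters of a sorted word.\<close>

lemma less_r_singleton_imp_less:
  assumes "less_r P [\<xi>]" and "sorted P" and "a \<in> set P"
  shows "a < \<xi>"
proof -
  obtain W \<eta> where "P = W @ [\<eta>]" "\<eta> < \<xi>"
    using assms(1) by (auto simp: less_r_def append_eq_Cons_conv Cons_eq_append_conv)
  then show ?thesis using assms(2,3) by (auto simp: sorted_append)
qed

lemma less_r_singletonI:
  assumes "P \<noteq> []" and "\<And>a. a \<in> set P \<Longrightarrow> a < \<xi>"
  shows "less_r P [\<xi>]"
  unfolding less_r_def
  by (rule exI[of _ "butlast P"], rule exI[of _ "[]"], rule exI[of _ "[]"],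
      rule exI[of _ "last P"], rule exI[of _ \<xi>]) (use assms in auto)

text \<open>The link from the word order to the multiset order. A proper suffix is a proper
  submultiset. Otherwise the comparison happens at \<xi>, and all letters of \<open>W\<close> lie
  below \<xi>; or at \<eta>, where \<xi> cancels and the remaining letters lie below \<eta>.\<close>

lemma less_rlex_pair_imp_less_multiset:
  assumes "less_rlex W [\<eta>, \<xi>]" and "\<eta> < \<xi>" and "sorted W"
  shows "mset W < {#\<eta>, \<xi>#}"
  using assms(1) unfolding less_rlex_def
proof
  assume "strict_suffix W [\<eta>, \<xi>]"
  then have "W = [] \<or> W = [\<xi>]"
    by (auto simp: strict_suffix_def suffix_def append_eq_Cons_conv Cons_eq_append_conv)
  then show ?thesis by (auto simp: add_mset_commute)
next
  assume "less_r W [\<eta>, \<xi>]"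
  then obtain W1 W2 W3 a b where W: "a < b" "W = W1 @ a # W3" "[\<eta>, \<xi>] = W2 @ b # W3"
    by (auto simp: less_r_def)
  from W(3) consider "W2 = []" "b = \<eta>" "W3 = [\<xi>]" | "W2 = [\<eta>]" "b = \<xi>" "W3 = []"
    by (auto simp: Cons_eq_append_conv)
  then show ?thesis
  proof cases
    case 1
    have "mset (W1 @ [a]) < {#\<eta>#}"
      by (rule ex_gt_imp_less_multiset) (use W 1 assms(3) in \<open>auto simp: sorted_append\<close>)
    then have "mset (W1 @ [a]) + {#\<xi>#} < {#\<eta>#} + {#\<xi>#}" by simp
    then show ?thesis using W 1 by (simp add: add_mset_commute)
  next
    case 2
    show ?thesis
      by (rule ex_gt_imp_less_multiset)
        (use W 2 assms(3) in \<open>auto simp: sorted_append intro!: exI[of _ \<xi>]\<close>)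
  qed
qed

text \<open>The order on the type of letters may fail to be well-founded. Ranking the finitely many
  letters embeds the relation into multisets of naturals.\<close>

lemma wf_less_multiset_finite:
  fixes \<Xi> :: "'i::linorder set"
  assumes "finite \<Xi>"
  shows "wf {(M, N). set_mset M \<subseteq> \<Xi> \<and> set_mset N \<subseteq> \<Xi> \<and> M < N}"
proof -
  define f where "f x = card {y \<in> \<Xi>. y < x}" for x
  have f: "f x < f y" if "x \<in> \<Xi>" "y \<in> \<Xi>" "x < y" for x y
    unfolding f_def by (rule psubset_card_mono) (use assms that in auto)
  have "{(M, N). set_mset M \<subseteq> \<Xi> \<and> set_mset N \<subseteq> \<Xi> \<and> M < N} \<subseteq>
      inv_image {(M, N :: nat multiset). M < N} (image_mset f)"
    by (auto intro!: image_mset_strict_mono f)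
  then show ?thesis
    by (rule wf_subset[rotated]) (intro wf_inv_image wf)
qed

lemma word_prod_append [simp]: "word_prod z (U @ V) = word_prod z U * word_prod z V"
  by (simp add: word_prod_def)

lemma word_prod_Nil [simp]: "word_prod z [] = 1"
  by (simp add: word_prod_def)

lemma word_prod_Cons [simp]: "word_prod z (x # V) = z x * word_prod z V"
  by (simp add: word_prod_def)

text \<open>The terms of the product of all z \<otimes> 1 + 1 \<otimes> z over the letters of the
  word. A list keeps their multiplicities, from which the integers n_AB are counted.\<close>

fun word_splits :: "'i list \<Rightarrow> ('i list \<times> 'i list) list"
  where
    "word_splits [] = [([], [])]"
  | "word_splits (x # V) =
      map (\<lambda>(a, b). (x # a, b)) (word_splits V) @ map (\<lambda>(a, b). (a, x # b)) (word_splits V)"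

lemma mset_word_splits: "(a, b) \<in> set (word_splits V) \<Longrightarrow> mset a + mset b = mset V"
  by (induction V arbitrary: a b) auto

lemma sorted_word_splits:
  "(a, b) \<in> set (word_splits V) \<Longrightarrow> sorted V \<Longrightarrow> sorted a \<and> sorted b"
proof (induction V arbitrary: a b)
  case (Cons x V)
  have "set c \<subseteq> set V \<and> set e \<subseteq> set V" if "(c, e) \<in> set (word_splits V)" for c e
    using arg_cong[OF mset_word_splits[OF that], of set_mset] by auto
  with Cons show ?case by fastforce
qed simp

text \<open>This is what makes the integers n_AB positive.\<close>

lemma word_splits_complete:
  "A + B = mset V \<Longrightarrow> \<exists>(a, b)\<in>set (word_splits V). mset a = A \<and> mset b = B"
proof (induction V arbitrary: A B)
  case (Cons x V)
  then have "x \<in># A + B" by simp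
  then consider "x \<in># A" | "x \<in># B" by auto
  then show ?case
  proof cases
    case 1
    then obtain A' where A: "A = add_mset x A'" by (metis insert_DiffM)
    with Cons.prems have "A' + B = mset V" by simp
    from Cons.IH[OF this] A show ?thesis by force
  next
    case 2
    then obtain B' where B: "B = add_mset x B'" by (metis insert_DiffM)
    with Cons.prems have "A + B' = mset V" by simp
    from Cons.IH[OF this] B show ?thesis by force
  qed
qed simp

section \<open>PBW generating systems\<close>

lemma tens_mult_tens [simp]: "tens_mult (tens a b) (tens c e) = tens (a * c) (b * e)"
  by (simp add: tens_mult_def)

lemma tens_mult_add_left: "tens_mult (x + y) w = tens_mult x w + tens_mult y w"
  by (simp add: tens_mult_def free.free_lift_add)

lemma tens_mult_add_right: "tens_mult x (y + w) = tens_mult x y + tens_mult x w"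
  by (simp add: tens_mult_def split_def free.free_lift_add free.free_lift_add_fun)

lemma tens_mult_scale_left: "tens_mult (free_scale c x) y = free_scale c (tens_mult x y)"
  by (simp add: tens_mult_def free.free_lift_free_scale)

lemma tens_mult_scale_right: "tens_mult x (free_scale c y) = free_scale c (tens_mult x y)"
  by (simp add: tens_mult_def free.free_lift_free_scale)
    (simp add: free_lift_def split_def free.scale_sum_right ac_simps)

lemma linear_tens_mult_left: "Vector_Spaces.linear free_scale free_scale (\<lambda>x. tens_mult x y)"
  by unfold_locales (simp_all add: tens_mult_add_left tens_mult_scale_left)

lemma linear_tens_mult_right: "Vector_Spaces.linear free_scale free_scale (tens_mult x)"
  by unfold_locales (simp_all add: tens_mult_add_right tens_mult_scale_right)

lemma tens_mult_mem_subspace: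
  assumes "free.subspace W" and "\<And>x y. x \<in> X \<Longrightarrow> y \<in> Y \<Longrightarrow> tens_mult x y \<in> W"
    and "x \<in> free_span X" and "y \<in> free_span Y"
  shows "tens_mult x y \<in> W"
proof (rule linear_image_mem_subspace[OF linear_tens_mult_left assms(1) _ assms(3)])
  fix x assume "x \<in> X"
  then show "tens_mult x y \<in> W"
    by (intro linear_image_mem_subspace[OF linear_tens_mult_right assms(1) _ assms(4)] assms(2))
qed

text \<open>The degree \<open>d\<close> is a parameter, and minimality enters only in
  \<open>filtration_eq_span\<close>: positivity of \<open>d_H\<close> has to be derived first, from
  exhaustiveness of the filtration.\<close>

locale dominated_PBW_system = hopf_algebra scale comult counit antipode
  for scale :: "'k::field_char_0 \<Rightarrow> 'h::ring_1 \<Rightarrow> 'h" and comult counit antipode +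
  fixes \<Xi> :: "'i::linorder set" and z :: "'i \<Rightarrow> 'h" and d :: "'i \<Rightarrow> nat"
  assumes finite_letters: "finite \<Xi>"
    and PBW: "PBW_generating_system scale \<Xi> z"
    and triangular: "triangular_system scale \<Xi> z d"
    and dominated: "dominated_system scale comult \<Xi> z d"
begin

section \<open>Monomials indexed by multisets\<close>

definition monomials :: "'i multiset set"
  where "monomials = {M. set_mset M \<subseteq> \<Xi>}"

text \<open>Non-decreasing words correspond to multisets, on which concatenation becomes addition
  and is compatible with the multiset order.\<close>

definition monomial :: "'i multiset \<Rightarrow> 'h"
  where "monomial M = word_prod z (sorted_list_of_multiset M)"

definition deg :: "'i multiset \<Rightarrow> nat"
  where "deg M = (\<Sum>x\<in>#M. d x)"

text \<open>The two bounds are independent of each other: the order drives the inductions, the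
  degree is what the filtration sees.\<close>

definition below :: "'i multiset \<Rightarrow> 'i multiset set"
  where "below M = {W \<in> monomials. W \<le> M \<and> deg W \<le> deg M}"

lemma deg_simps [simp]: "deg {#} = 0" "deg (add_mset x M) = d x + deg M" "deg (M + N) = deg M + deg N"
  by (simp_all add: deg_def)

lemma monomials_simps [simp]: "{#} \<in> monomials"
  "add_mset x M \<in> monomials \<longleftrightarrow> x \<in> \<Xi> \<and> M \<in> monomials"
  "M + N \<in> monomials \<longleftrightarrow> M \<in> monomials \<and> N \<in> monomials"
  "mset V \<in> monomials \<longleftrightarrow> set V \<subseteq> \<Xi>"
  by (auto simp: monomials_def)

lemma word_degree_eq: "word_degree d V = deg (mset V)"
  by (induction V) (auto simp: word_degree_def)

lemma monomial_mset: "sorted V \<Longrightarrow> monomial (mset V) = word_prod z V"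
  by (simp add: monomial_def sorted_sort_id)

lemma monomial_empty [simp]: "monomial {#} = 1"
  by (simp add: monomial_def)

lemma monomial_single [simp]: "monomial {#x#} = z x"
  by (simp add: monomial_def)

lemma nondecreasing_words_eq: "nondecreasing_words \<Xi> = sorted_list_of_multiset ` monomials"
proof (intro equalityI subsetI)
  fix V assume V: "V \<in> nondecreasing_words \<Xi>"
  then have "V = sorted_list_of_multiset (mset V)"
    by (simp add: nondecreasing_words_def sorted_sort_id)
  with V show "V \<in> sorted_list_of_multiset ` monomials"
    by (intro image_eqI[of _ _ "mset V"]) (auto simp: nondecreasing_words_def)
qed (auto simp: nondecreasing_words_def monomials_def)

lemma word_prod_nondecreasing_words:
  "word_prod z ` {V \<in> nondecreasing_words \<Xi>. P (mset V)} = monomial ` {M \<in> monomials. P M}"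
  by (force simp: nondecreasing_words_eq monomial_def)

lemma inj_on_monomial: "inj_on monomial monomials"
proof -
  have "inj_on (word_prod z \<circ> sorted_list_of_multiset) monomials"
    using PBW unfolding PBW_generating_system_def nondecreasing_words_eq
    by (intro comp_inj_on) (auto intro: inj_on_inverseI[of _ mset])
  then show ?thesis by (simp add: monomial_def comp_def cong: inj_on_cong)
qed

lemma independent_monomials: "independent (monomial ` monomials)"
  and span_monomials: "span (monomial ` monomials) = UNIV"
  using PBW unfolding PBW_generating_system_def
  by (simp_all add: nondecreasing_words_eq image_image monomial_def[abs_def])

section \<open>Straightening words into monomials\<close>

lemma monomial_wf_induct [consumes 1, case_names less]:
  assumes "M \<in> monomials"
    and "\<And>M. M \<in> monomials \<Longrightarrow> (\<And>N. N \<in> monomials \<Longrightarrow> N < M \<Longrightarrow> P N) \<Longrightarrow> P M"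
  shows "P M"
  using assms(1)
proof (induction M rule: wf_induct_rule[OF wf_less_multiset_finite[OF finite_letters]])
  case (1 M)
  then show ?case using assms(2)[of M] by (simp add: monomials_def)
qed

lemma linear_mult_both: "Vector_Spaces.linear scale scale (\<lambda>h. a * h * b)"
  by unfold_locales (simp_all add: algebra_simps scale_mult_left scale_mult_right)

text \<open>Outer induction on the multiset of the word, inner sorting by swaps. Each swap is a
  triangular relation whose error words have a smaller multiset and no larger degree.\<close>

lemma word_prod_in_span_below:
  assumes "set A \<subseteq> \<Xi>"
  shows "word_prod z A \<in> span (monomial ` below (mset A))"
proof -
  have "\<forall>A. mset A = M \<longrightarrow> word_prod z A \<in> span (monomial ` below M)" if "M \<in> monomials" for M
    using that
  proof (induction M rule: monomial_wf_induct)
    case (less M)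
    let ?L = "span (monomial ` below M)"
    \<comment> \<open>Swaps preserve the multiset, so \<open>P\<close> speaks only of words with
      multiset \<open>M\<close>.\<close>
    define P where "P A \<longleftrightarrow> (mset A = M \<longrightarrow> word_prod z A \<in> ?L)" for A
    have "P A" for A
    proof (rule sort_by_swaps[of P A])
      have "sorted_list_of_multiset M = sort A" if "mset A = M"
        using that by (metis sorted_list_of_multiset_mset)
      moreover have "M \<in> below M" using less.hyps by (simp add: below_def)
      ultimately show "P (sort A)"
        unfolding P_def by (metis monomial_mset mset_sort sorted_sort span_base image_eqI)
    next
      fix X x y Y
      assume "y < x" and swapped: "P (X @ y # x # Y)"
      show "P (X @ x # y # Y)"
        unfolding P_def
      proof
        assume M: "mset (X @ x # y # Y) = M"
        then have in_\<Xi>: "set X \<subseteq> \<Xi>" "set Y \<subseteq> \<Xi>" "x \<in> \<Xi>" "y \<in> \<Xi>"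
          using less.hyps by (auto simp: monomials_def)
        from triangular[unfolded triangular_system_def, rule_format, OF this(4,3) \<open>y < x\<close>]
        obtain c h where zz: "z x * z y = scale c (z y * z x) + h"
          and h: "h \<in> span {word_prod z W | W. W \<in> nondecreasing_words_plus \<Xi> \<and>
            word_degree d W \<le> word_degree d [y, x] \<and> less_rlex W [y, x]}"
          by auto
        have "word_prod z X * h * word_prod z Y \<in> ?L"
        proof (rule linear_image_mem_subspace[OF linear_mult_both subspace_span _ h], clarify)
          fix W
          assume W: "W \<in> nondecreasing_words_plus \<Xi>"
            and deg: "word_degree d W \<le> word_degree d [y, x]" and rlex: "less_rlex W [y, x]"
          \<comment> \<open>Error words are smaller in the multiset order, and this survives adding
            the letters of \<open>X\<close> and \<open>Y\<close>; hence the outer induction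
            applies.\<close>
          have "mset W < {#y, x#}"
            using rlex \<open>y < x\<close> W less_rlex_pair_imp_less_multiset
            by (auto simp: nondecreasing_words_plus_def nondecreasing_words_def)
          then have "mset W + (mset X + mset Y) < {#y, x#} + (mset X + mset Y)" by simp
          then have less_M: "mset (X @ W @ Y) < M" by (simp add: M[symmetric] ac_simps)
          have deg_M: "deg (mset (X @ W @ Y)) \<le> deg M"
            using deg unfolding word_degree_eq M[symmetric] by simp
          have mon: "mset (X @ W @ Y) \<in> monomials"
            using W in_\<Xi> by (auto simp: nondecreasing_words_plus_def nondecreasing_words_def)
          have "word_prod z (X @ W @ Y) \<in> span (monomial ` below (mset (X @ W @ Y)))"
            using less.IH[OF mon less_M] by blast
          also have "\<dots> \<subseteq> ?L"
            using less_M deg_M by (intro span_mono image_mono) (auto simp: below_def)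
          finally show "word_prod z X * word_prod z W * word_prod z Y \<in> ?L"
            by (simp add: mult.assoc)
        qed
        moreover have "word_prod z (X @ y # x # Y) \<in> ?L"
          using swapped M by (simp add: P_def add_mset_commute)
        ultimately have "scale c (word_prod z (X @ y # x # Y)) + word_prod z X * h * word_prod z Y \<in> ?L"
          by (intro span_add span_scale)
        also have "scale c (word_prod z (X @ y # x # Y)) + word_prod z X * h * word_prod z Y =
            word_prod z X * (z x * z y) * word_prod z Y"
          by (simp add: zz algebra_simps scale_mult_left scale_mult_right)
        also have "\<dots> = word_prod z (X @ x # y # Y)" by (simp add: mult.assoc)
        finally show "word_prod z (X @ x # y # Y) \<in> ?L" .
      qed
    qed
    then show ?case by (simp add: P_def)
  qed
  from this[of "mset A"] assms show ?thesis by simp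
qed

section \<open>The coproduct of a monomial up to lower terms\<close>

text \<open>With the relations included, this is the preimage in formal sums of a subspace of H
  \<otimes> H.\<close>

definition tensor_monomials :: "('i multiset \<times> 'i multiset) set \<Rightarrow> ('h \<times> 'h \<Rightarrow>\<^sub>0 'k) set"
  where "tensor_monomials S =
    free_span ((\<lambda>(A, B). tens (monomial A) (monomial B)) ` S \<union> tensor_relations scale)"

text \<open>Index set of the error terms of \<Delta>(b_V). The bound is on A + B, so that it adds up
  when coproducts are multiplied.\<close>

definition lower :: "'i multiset \<Rightarrow> ('i multiset \<times> 'i multiset) set"
  where "lower V = {(A, B). A \<in> monomials \<and> B \<in> monomials \<and> A + B < V \<and> deg A + deg B \<le> deg V}"

lemma subspace_tensor_monomials: "free.subspace (tensor_monomials S)"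
  by (simp add: tensor_monomials_def)

lemma tensor_monomials_mono: "S \<subseteq> T \<Longrightarrow> tensor_monomials S \<subseteq> tensor_monomials T"
  unfolding tensor_monomials_def by (intro free.span_mono) blast

lemma tens_word_prod_mem:
  assumes "set p \<subseteq> \<Xi>" and "set q \<subseteq> \<Xi>" and "below (mset p) \<times> below (mset q) \<subseteq> S"
  shows "tens (word_prod z p) (word_prod z q) \<in> tensor_monomials S"
proof (rule tens_span_left[OF word_prod_in_span_below[OF assms(1)] subspace_tensor_monomials])
  show rel: "tensor_relations scale \<subseteq> tensor_monomials S"
    unfolding tensor_monomials_def using free.span_superset by blast
  fix a assume "a \<in> monomial ` below (mset p)"
  then obtain A where A: "A \<in> below (mset p)" "a = monomial A" by blast
  show "tens a (word_prod z q) \<in> tensor_monomials S"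
  proof (rule tens_span_right[OF word_prod_in_span_below[OF assms(2)] subspace_tensor_monomials rel])
    fix b assume "b \<in> monomial ` below (mset q)"
    then obtain B where "B \<in> below (mset q)" "b = monomial B" by blast
    with A assms(3) show "tens a b \<in> tensor_monomials S"
      unfolding tensor_monomials_def by (intro free.span_base) force
  qed
qed

lemma below_times_subset_lower:
  assumes "M + N < V" and "deg M + deg N \<le> deg V"
  shows "below M \<times> below N \<subseteq> lower V"
proof clarify
  fix A B assume "A \<in> below M" "B \<in> below N"
  moreover from this have "A + B \<le> M + N" by (auto simp: below_def intro: add_mono)
  ultimately show "(A, B) \<in> lower V" using assms by (auto simp: lower_def below_def)
qed

abbreviation tens_words :: "'i list \<times> 'i list \<Rightarrow> ('h \<times> 'h \<Rightarrow>\<^sub>0 'k)"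
  where "tens_words pq \<equiv> tens (word_prod z (fst pq)) (word_prod z (snd pq))"

text \<open>Domination bounds the two words separately. As all their letters lie below x, the
  multiset order puts even the union of both below the single letter x.\<close>

lemma comult_letter:
  assumes "x \<in> \<Xi>"
  obtains t where "tens 1 (z x) + tens (z x) 1 + t \<in> comult (z x)"
    and "t \<in> free_span (tens_words ` {(p, q). set p \<subseteq> \<Xi> \<and> set q \<subseteq> \<Xi> \<and>
      mset p + mset q < {#x#} \<and> deg (mset p) + deg (mset q) \<le> d x})"
proof -
  from dominated assms obtain t where c: "comult (z x) = tensor_class scale (tens 1 (z x) + tens (z x) 1 + t)"
    and t: "t \<in> free_span {tens (word_prod z P) (word_prod z Q) | P Q.
          P \<in> nondecreasing_words_plus \<Xi> \<and> Q \<in> nondecreasing_words_plus \<Xi> \<and>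
          word_degree d (P @ Q) \<le> d x \<and> less_r P [x] \<and> less_r Q [x]}" (is "_ \<in> free_span ?T")
    unfolding dominated_system_def by fastforce
  have "?T \<subseteq> tens_words ` {(p, q). set p \<subseteq> \<Xi> \<and> set q \<subseteq> \<Xi> \<and>
      mset p + mset q < {#x#} \<and> deg (mset p) + deg (mset q) \<le> d x}"
  proof clarify
    fix P Q assume "P \<in> nondecreasing_words_plus \<Xi>" "Q \<in> nondecreasing_words_plus \<Xi>"
      "word_degree d (P @ Q) \<le> d x" "less_r P [x]" "less_r Q [x]"
    moreover from this have "\<And>a. a \<in> set P \<union> set Q \<Longrightarrow> a < x"
      using less_r_singleton_imp_less
      by (auto simp: nondecreasing_words_plus_def nondecreasing_words_def)
    ultimately show "tens (word_prod z P) (word_prod z Q) \<in> tens_words ` {(p, q). set p \<subseteq> \<Xi> \<and>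
      set q \<subseteq> \<Xi> \<and> mset p + mset q < {#x#} \<and> deg (mset p) + deg (mset q) \<le> d x}"
      by (intro image_eqI[of _ _ "(P, Q)"])
        (auto simp: nondecreasing_words_plus_def nondecreasing_words_def word_degree_eq)
  qed
  then have "t \<in> free_span (tens_words ` {(p, q). set p \<subseteq> \<Xi> \<and> set q \<subseteq> \<Xi> \<and>
      mset p + mset q < {#x#} \<and> deg (mset p) + deg (mset q) \<le> d x})"
    using t free.span_mono by blast
  moreover have "tens 1 (z x) + tens (z x) 1 + t \<in> comult (z x)"
    by (simp add: c tensor_class_def free.subspace_0[OF subspace_tensor_relations])
  ultimately show thesis using that by blast
qed

lemma tens_mult_tens_words:
  "tens_mult (tens_words (p, q)) (tens_words (a, b)) = tens_words (p @ a, q @ b)"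
  by simp

text \<open>The leading part of \<open>\<Delta>(z\<^sub>V)\<close> is obtained by distributing the letters of \<open>V\<close> over the two
  factors.\<close>

lemma comult_word_prod:
  assumes "set V \<subseteq> \<Xi>"
  obtains y where "y \<in> comult (word_prod z V)"
    and "y - sum_list (map tens_words (word_splits V)) \<in> tensor_monomials (lower (mset V))"
proof -
  let ?main = "\<lambda>V. sum_list (map tens_words (word_splits V))"
  have "\<exists>y\<in>comult (word_prod z V). y - ?main V \<in> tensor_monomials (lower (mset V))"
    using assms
  proof (induction V)
    case Nil
    show ?case
      using comult_one by (intro bexI[of _ "tens 1 1"]) (simp_all add: free.subspace_0[OF subspace_tensor_monomials])
  next
    case (Cons x V)
    let ?W = "tensor_monomials (lower (mset (x # V)))"
    let ?L = "{(a, b). set a \<subseteq> \<Xi> \<and> set b \<subseteq> \<Xi> \<and> mset a + mset b < mset V \<and>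
      deg (mset a) + deg (mset b) \<le> deg (mset V)}"
    let ?S = "{(a, b). set a \<subseteq> \<Xi> \<and> set b \<subseteq> \<Xi> \<and> mset a + mset b \<le> mset V \<and>
      deg (mset a) + deg (mset b) \<le> deg (mset V)}"
    let ?T = "{(p, q). set p \<subseteq> \<Xi> \<and> set q \<subseteq> \<Xi> \<and> mset p + mset q < {#x#} \<and>
      deg (mset p) + deg (mset q) \<le> d x}"
    obtain y where y: "y \<in> comult (word_prod z V)"
      "y - ?main V \<in> tensor_monomials (lower (mset V))" using Cons by auto
    have "(\<lambda>(A, B). tens (monomial A) (monomial B)) ` lower (mset V) \<subseteq> tens_words ` ?L"
    proof clarify
      fix A B assume "(A, B) \<in> lower (mset V)"
      then show "tens (monomial A) (monomial B) \<in> tens_words ` ?L"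
        by (intro image_eqI[of _ _ "(sorted_list_of_multiset A, sorted_list_of_multiset B)"])
          (auto simp: lower_def monomial_def monomials_def)
    qed
    then have "y - ?main V \<in> free_span (tens_words ` ?L \<union> tensor_relations scale)"
      using y(2) unfolding tensor_monomials_def
      by (meson Un_mono free.span_mono subset_refl subsetD)
    \<comment> \<open>The error splits into tensors of words \<open>l\<close> and relations
      \<open>r\<close>. The latter are absorbed by passing to another representative, so that
      multiplication by a letter becomes concatenation.\<close>
    then obtain l r where l: "l \<in> free_span (tens_words ` ?L)"
      and r: "r \<in> free_span (tensor_relations scale)" and yl: "y - ?main V = l + r"
      by (auto simp: free.span_Un)
    have "r \<in> tensor_relations scale"
      using r subspace_tensor_relations free.span_eq_iff by metis
    moreover have "(?main V + l) - y = - r" using yl by (simp add: algebra_simps)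
    ultimately have y': "?main V + l \<in> comult (word_prod z V)"
      using mem_comult_iff[OF y(1), of "?main V + l"]
      by (simp add: free.subspace_neg[OF subspace_tensor_relations])
    obtain t where t: "tens 1 (z x) + tens (z x) 1 + t \<in> comult (z x)" "t \<in> free_span (tens_words ` ?T)"
      using Cons.prems by (auto elim: comult_letter[of x])
    have W: "tens_words (a, b) \<in> ?W"
      if "set a \<subseteq> \<Xi>" "set b \<subseteq> \<Xi>" "mset a + mset b < mset (x # V)"
        "deg (mset a) + deg (mset b) \<le> deg (mset (x # V))" for a b
      unfolding fst_conv snd_conv using that
      by (intro tens_word_prod_mem below_times_subset_lower) auto
    \<comment> \<open>Sending x to the right or to the left factor is exactly the recursion of
      \<open>word_splits\<close>.\<close>
    have main_split: "tens_mult (tens 1 (z x) + tens (z x) 1) (?main V) = ?main (x # V)"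
      unfolding linear_sum_list[OF linear_tens_mult_right]
      by (simp add: tens_mult_add_left sum_list_addf comp_def split_def add.commute)
    \<comment> \<open>The leading part of the letter has total multiset exactly x, so strictness
      comes from \<open>l\<close>. In the product with \<open>t\<close> below it comes from
      \<open>t\<close>, and a weak bound on \<open>?main V + l\<close> suffices.\<close>
    have "tens_mult (tens 1 (z x) + tens (z x) 1) l \<in> ?W"
    proof (rule tens_mult_mem_subspace[OF subspace_tensor_monomials _ _ l])
      show "tens 1 (z x) + tens (z x) 1 \<in> free_span (tens_words ` {([], [x]), ([x], [])})"
        by (intro free.span_add free.span_base) auto
    next
      fix u v assume "u \<in> tens_words ` {([], [x]), ([x], [])}" "v \<in> tens_words ` ?L"
      then obtain p q a b where uv: "u = tens_words (p, q)" "v = tens_words (a, b)"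
        and pq: "(p, q) \<in> {([], [x]), ([x], [])}" and ab: "(a, b) \<in> ?L" by (auto simp del: fst_conv snd_conv)
      have pqx: "mset p + mset q = {#x#}" using pq by auto
      have "(mset p + mset q) + (mset a + mset b) < {#x#} + mset V"
        using ab by (auto simp: pqx)
      moreover have "deg (mset p + mset q) + (deg (mset a) + deg (mset b)) \<le> d x + deg (mset V)"
        using ab by (auto simp: pqx)
      ultimately show "tens_mult u v \<in> ?W"
        unfolding uv tens_mult_tens_words using ab pq Cons.prems
        by (intro W) (auto simp: ac_simps)
    qed
    moreover have main_l: "?main V + l \<in> free_span (tens_words ` ?S)"
    proof (rule free.span_add)
      show "l \<in> free_span (tens_words ` ?S)"
        using l by (rule free.span_mono[THEN subsetD, rotated]) (auto intro!: image_eqI[OF refl])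
      have "set (word_splits V) \<subseteq> ?S"
      proof clarify
        fix a b assume "(a, b) \<in> set (word_splits V)"
        from mset_word_splits[OF this] have *: "mset a + mset b = mset V" .
        have "set a \<union> set b = set V" by (metis * set_mset_mset set_mset_union)
        then have "set a \<subseteq> \<Xi>" "set b \<subseteq> \<Xi>" using Cons.prems by auto
        moreover have "deg (mset a) + deg (mset b) = deg (mset V)" by (metis * deg_simps(3))
        ultimately show "set a \<subseteq> \<Xi> \<and> set b \<subseteq> \<Xi> \<and> mset a + mset b \<le> mset V \<and>
          deg (mset a) + deg (mset b) \<le> deg (mset V)" using * by simp
      qed
      then show "?main V \<in> free_span (tens_words ` ?S)"
        by (intro subspace_sum_list[OF free.subspace_span]) (auto intro!: free.span_base)
    qed
    have "tens_mult t (?main V + l) \<in> ?W"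
    proof (rule tens_mult_mem_subspace[OF subspace_tensor_monomials _ t(2) main_l])
      fix u v assume "u \<in> tens_words ` ?T" "v \<in> tens_words ` ?S"
      then obtain p q a b where uv: "u = tens_words (p, q)" "v = tens_words (a, b)"
        and pq: "(p, q) \<in> ?T" and ab: "(a, b) \<in> ?S" by (auto simp del: fst_conv snd_conv)
      have "(mset p + mset q) + (mset a + mset b) < {#x#} + mset V"
        using ab pq by (intro add_less_le_mono) auto
      moreover have "deg (mset p + mset q) + (deg (mset a) + deg (mset b)) \<le> d x + deg (mset V)"
        using ab pq by auto
      ultimately show "tens_mult u v \<in> ?W"
        unfolding uv tens_mult_tens_words using ab pq
        by (intro W) (auto simp: ac_simps)
    qed
    ultimately have "tens_mult (tens 1 (z x) + tens (z x) 1) l + tens_mult t (?main V + l) \<in> ?W"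
      by (rule free.subspace_add[OF subspace_tensor_monomials])
    also have "tens_mult (tens 1 (z x) + tens (z x) 1) l + tens_mult t (?main V + l) =
      tens_mult (tens 1 (z x) + tens (z x) 1 + t) (?main V + l) - ?main (x # V)"
      unfolding main_split[symmetric] by (simp only: tens_mult_add_left tens_mult_add_right) simp
    finally show ?case
      using comult_mult[OF t(1) y'] by (intro bexI) auto
  qed
  then show thesis using that by blast
qed

section \<open>Coordinates in the PBW basis and their contractions\<close>

definition coeff :: "'i multiset \<Rightarrow> 'h \<Rightarrow> 'k"
  where "coeff M h = representation (monomial ` monomials) h (monomial M)"

definition support :: "'h \<Rightarrow> 'i multiset set"
  where "support h = {M \<in> monomials. coeff M h \<noteq> 0}"

lemma linear_coeff: "Vector_Spaces.linear scale (*) (coeff M)"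
  unfolding coeff_def by (rule linear_representation[OF independent_monomials span_monomials])

lemma coeff_monomial:
  "M \<in> monomials \<Longrightarrow> N \<in> monomials \<Longrightarrow> coeff M (monomial N) = (if M = N then 1 else 0)"
  by (auto simp: coeff_def representation_basis[OF independent_monomials]
      dest: inj_onD[OF inj_on_monomial])

lemma finite_support: "finite (support h)"
proof (rule finite_imageD)
  show "finite (monomial ` support h)"
    by (rule finite_subset[OF _ finite_representation[of "monomial ` monomials" h]])
      (auto simp: support_def coeff_def)
  show "inj_on monomial (support h)"
    by (rule inj_on_subset[OF inj_on_monomial]) (auto simp: support_def)
qed

lemma monomial_expansion: "h = (\<Sum>M\<in>support h. scale (coeff M h) (monomial M))"
proof -
  have "{b. representation (monomial ` monomials) h b \<noteq> 0} = monomial ` support h"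
    by (auto simp: support_def coeff_def dest: representation_ne_zero)
  moreover have "inj_on monomial (support h)"
    by (rule inj_on_subset[OF inj_on_monomial]) (auto simp: support_def)
  ultimately show ?thesis
    using sum_nonzero_representation_eq[OF independent_monomials, of h] span_monomials
    by (simp add: sum.reindex coeff_def)
qed

lemma linear_eq_sum_support:
  assumes "Vector_Spaces.linear scale s T"
  shows "T h = (\<Sum>M\<in>support h. s (coeff M h) (T (monomial M)))"
proof -
  interpret T: Vector_Spaces.linear scale s T by fact
  have "T h = T (\<Sum>M\<in>support h. scale (coeff M h) (monomial M))"
    using monomial_expansion[of h] by (rule arg_cong)
  then show ?thesis by (simp add: T.sum T.scale)
qed

lemma coeff_eq_0_if_span:
  assumes "h \<in> span (monomial ` S)" and "S \<subseteq> monomials" and "M \<in> monomials - S"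
  shows "coeff M h = 0"
proof -
  interpret coeff: Vector_Spaces.linear scale "(*)" "coeff M" by (rule linear_coeff)
  have "coeff M h \<in> {0}"
    by (rule linear_image_mem_subspace[OF linear_coeff coeff.vs2.subspace_single_0 _ assms(1)])
      (use assms(2,3) in \<open>auto simp: coeff_monomial subset_iff\<close>)
  then show ?thesis by simp
qed

lemma span_if_support: "support h \<subseteq> S \<Longrightarrow> h \<in> span (monomial ` S)"
  by (subst monomial_expansion, intro span_sum span_scale span_base) auto

lemma linear_coeff_act: "Vector_Spaces.linear scale (*) (\<lambda>h. coeff P (act (coeff Q) h))"
  using Vector_Spaces.linear_compose[OF linear_act[OF linear_coeff] linear_coeff] by (simp add: comp_def)

text \<open>The composite is the coordinate of b_P \<otimes> b_Q in H \<otimes> H: it kills the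
  relations and every basis tensor with another index pair.\<close>

lemma coeff_contract_tensor_monomials:
  assumes "x \<in> tensor_monomials S" and "S \<subseteq> monomials \<times> monomials"
    and "P \<in> monomials" and "Q \<in> monomials" and "(P, Q) \<notin> S"
  shows "coeff P (free_lift scale (\<lambda>(a, b). scale (coeff Q b) a) x) = 0"
proof -
  let ?F = "free_lift scale (\<lambda>(a, b). scale (coeff Q b) a)"
  interpret coeff: Vector_Spaces.linear scale "(*)" "coeff P" by (rule linear_coeff)
  have "coeff P (?F x) \<in> {0}"
  proof (rule linear_image_mem_subspace[OF _ coeff.vs2.subspace_single_0 _
        assms(1)[unfolded tensor_monomials_def], where f = "\<lambda>x. coeff P (?F x)"])
    show "Vector_Spaces.linear free_scale (*) (\<lambda>x. coeff P (?F x))"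
      using Vector_Spaces.linear_compose[OF linear_free_lift linear_coeff] by (simp add: comp_def)
  next
    fix t assume "t \<in> (\<lambda>(A, B). tens (monomial A) (monomial B)) ` S \<union> tensor_relations scale"
    then show "coeff P (?F t) \<in> {0}"
    proof
      assume "t \<in> tensor_relations scale"
      then show ?thesis by (simp add: contract_tensor_relations[OF linear_coeff])
    next
      assume "t \<in> (\<lambda>(A, B). tens (monomial A) (monomial B)) ` S"
      then obtain A B where "(A, B) \<in> S" "t = tens (monomial A) (monomial B)" by auto
      with assms show ?thesis by (auto simp: coeff.scale coeff_monomial subset_iff)
    qed
  qed
  then show ?thesis by simp
qed

text \<open>The coordinate is a count of splittings plus a contribution of the lower terms. The
  count vanishes unless P + Q = V, while lower terms have P + Q < V, so the two never
  interfere.\<close>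

lemma coeff_act_monomial:
  assumes V: "V \<in> monomials" and P: "P \<in> monomials" and Q: "Q \<in> monomials"
  shows "coeff P (act (coeff Q) (monomial V)) \<noteq> 0 \<longrightarrow> P + Q \<le> V \<and> deg P + deg Q \<le> deg V"
    and "P + Q = V \<Longrightarrow> coeff P (act (coeff Q) (monomial V)) \<noteq> 0"
proof -
  let ?F = "free_lift scale (\<lambda>(a, b). scale (coeff Q b) a)"
  interpret coeff: Vector_Spaces.linear scale "(*)" "coeff P" by (rule linear_coeff)
  interpret F: Vector_Spaces.linear free_scale scale ?F by (rule linear_free_lift)
  define V' where "V' = sorted_list_of_multiset V"
  have V': "set V' \<subseteq> \<Xi>" "mset V' = V" "sorted V'" "monomial V = word_prod z V'"
    using V by (auto simp: V'_def monomials_def monomial_def)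
  define main where "main = sum_list (map tens_words (word_splits V'))"
  obtain y where y: "y \<in> comult (monomial V)" "y - main \<in> tensor_monomials (lower V)"
    using comult_word_prod[OF V'(1)] V' by (auto simp: main_def)
  \<comment> \<open>The integer n_PQ: the number of ways to deal out the letters of \<open>V\<close>
    as \<open>P\<close> and \<open>Q\<close>.\<close>
  let ?n = "length (filter (\<lambda>(a, b). mset a = P \<and> mset b = Q) (word_splits V'))"
  have "coeff P (?F (tens_words ab)) = (if mset (fst ab) = P \<and> mset (snd ab) = Q then 1 else 0)"
    if "ab \<in> set (word_splits V')" for ab
  proof -
    obtain a b where ab: "ab = (a, b)" by fastforce
    have "set_mset (mset a + mset b) = set V'"
      using mset_word_splits[of a b V'] that ab by (metis set_mset_mset)
    then have "mset a \<in> monomials" "mset b \<in> monomials" using V' by auto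
    moreover have "word_prod z a = monomial (mset a)" "word_prod z b = monomial (mset b)"
      using sorted_word_splits[of a b V'] that ab V' by (simp_all add: monomial_mset)
    ultimately show ?thesis using P Q by (auto simp: ab coeff.scale coeff_monomial)
  qed
  then have coeffs: "map (\<lambda>ab. coeff P (?F (tens_words ab))) (word_splits V') =
      map (\<lambda>ab. if mset (fst ab) = P \<and> mset (snd ab) = Q then 1 else 0) (word_splits V')"
    by (intro map_cong refl)
  have count: "sum_list (map (\<lambda>ab. if mset (fst ab) = P \<and> mset (snd ab) = Q then 1 else 0) xs) =
      (of_nat (length (filter (\<lambda>(a, b). mset a = P \<and> mset b = Q) xs)) :: 'k)" for xs
    by (induction xs) auto
  have main: "coeff P (?F main) = of_nat ?n"
    unfolding main_def linear_sum_list[OF linear_free_lift] linear_sum_list[OF linear_coeff]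
      map_map comp_def coeffs count ..
  have lower: "coeff P (?F (y - main)) = 0" if "(P, Q) \<notin> lower V"
    by (rule coeff_contract_tensor_monomials[OF y(2)]) (use that P Q in \<open>auto simp: lower_def\<close>)
  have act: "coeff P (act (coeff Q) (monomial V)) = coeff P (?F (y - main)) + of_nat ?n"
    by (simp add: act_eq[OF linear_coeff y(1)] F.diff coeff.diff flip: main)
  show "coeff P (act (coeff Q) (monomial V)) \<noteq> 0 \<longrightarrow> P + Q \<le> V \<and> deg P + deg Q \<le> deg V"
  proof
    assume "coeff P (act (coeff Q) (monomial V)) \<noteq> 0"
    then consider "(P, Q) \<in> lower V" | "?n \<noteq> 0" using act lower by fastforce
    then show "P + Q \<le> V \<and> deg P + deg Q \<le> deg V"
    proof cases
      case 1
      then show ?thesis by (auto simp: lower_def)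
    next
      case 2
      then obtain a b where "(a, b) \<in> set (word_splits V')" "mset a = P" "mset b = Q"
        by (auto simp: filter_empty_conv)
      with mset_word_splits[OF this(1)] V' have "P + Q = V" by simp
      then show ?thesis by auto
    qed
  qed
  show "coeff P (act (coeff Q) (monomial V)) \<noteq> 0" if "P + Q = V"
  proof -
    have "P + Q = mset V'" using that V' by simp
    from word_splits_complete[OF this]
    obtain a b where "(a, b) \<in> set (word_splits V')" "mset a = P" "mset b = Q" by auto
    then have "?n \<noteq> 0" by (auto simp: filter_empty_conv)
    moreover have "(P, Q) \<notin> lower V" using that by (simp add: lower_def)
    \<comment> \<open>Characteristic zero enters here: the positive integer \<open>?n\<close> stays
      nonzero in the field.\<close>
    ultimately show ?thesis using act lower by simp
  qed
qed

text \<open>Only monomials at least as large as \<open>V\<close> in both order and degree can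
  contribute. The hypothesis thus fits both a \<open>V\<close> largest in the whole support and one
  largest among the monomials of top degree.\<close>

lemma coeff_act_leading:
  assumes V: "V \<in> support h" and P: "P \<in> monomials" and Q: "Q \<in> monomials" and PQ: "P + Q = V"
    and leading: "\<And>W. W \<in> support h \<Longrightarrow> V \<le> W \<Longrightarrow> deg V \<le> deg W \<Longrightarrow> W = V"
  shows "coeff P (act (coeff Q) h) \<noteq> 0"
proof -
  have "coeff P (act (coeff Q) h) =
      (\<Sum>W\<in>support h. coeff W h * coeff P (act (coeff Q) (monomial W)))"
    by (rule linear_eq_sum_support[OF linear_coeff_act])
  also have "\<dots> = (\<Sum>W\<in>{V}. coeff W h * coeff P (act (coeff Q) (monomial W)))"
  proof (rule sum.mono_neutral_right[OF finite_support])
    show "\<forall>W\<in>support h - {V}. coeff W h * coeff P (act (coeff Q) (monomial W)) = 0"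
    proof
      fix W assume W: "W \<in> support h - {V}"
      then have "\<not> (V \<le> W \<and> deg V \<le> deg W)" using leading by blast
      then have "coeff P (act (coeff Q) (monomial W)) = 0"
        using coeff_act_monomial(1)[of W P Q] W P Q PQ by (auto simp: support_def)
      then show "coeff W h * coeff P (act (coeff Q) (monomial W)) = 0" by simp
    qed
  qed (use V in auto)
  also have "\<dots> \<noteq> 0"
    using V coeff_act_monomial(2)[of V P Q] P Q PQ by (simp add: support_def)
  finally show ?thesis .
qed

section \<open>The coradical\<close>

text \<open>For the largest \<open>V\<close> in the support of \<open>h\<close>, contracting \<open>\<Delta>(h)\<close> with the coordinate of \<open>V\<close>
  gives a nonzero multiple of 1.\<close>

lemma one_mem_subcoalgebra:
  assumes C: "subcoalgebra scale comult C" and h: "h \<in> C" "h \<noteq> 0"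
  shows "1 \<in> C"
proof -
  have "support h \<noteq> {}" using h(2) monomial_expansion[of h] by auto
  define V where "V = Max (support h)"
  have V: "V \<in> support h" unfolding V_def by (rule Max_in) (fact finite_support \<open>support h \<noteq> {}\<close>)+
  have V_max: "W \<le> V" if "W \<in> support h" for W unfolding V_def using that finite_support by simp
  have V_mon: "V \<in> monomials" using V by (simp add: support_def)
  let ?u = "act (coeff V) h"
  \<comment> \<open>A nonempty \<open>P\<close> would give P + V > V, although \<open>V\<close>
    bounds the whole support; only the coordinate at the empty monomial survives.\<close>
  have "coeff P ?u = 0" if "P \<in> monomials" "P \<noteq> {#}" for P
  proof -
    have "coeff P (act (coeff V) (monomial W)) = 0" if W: "W \<in> support h" for W
    proof (rule ccontr)
      assume "coeff P (act (coeff V) (monomial W)) \<noteq> 0"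
      then have "P + V \<le> W"
        using coeff_act_monomial(1)[of W P V] W \<open>P \<in> monomials\<close> V_mon by (auto simp: support_def)
      also have "\<dots> \<le> V" using V_max[OF W] .
      finally show False using \<open>P \<noteq> {#}\<close>
        by (metis add.commute add_cancel_right_right less_eq_multiset_empty_left
            add_le_same_cancel2 antisym)
    qed
    then show ?thesis by (subst linear_eq_sum_support[OF linear_coeff_act]) simp
  qed
  moreover have 0: "coeff {#} ?u \<noteq> 0"
    by (rule coeff_act_leading[OF V _ V_mon]) (use V_max in \<open>auto intro: antisym\<close>)
  ultimately have "support ?u = {{#}}" by (auto simp: support_def)
  then have "?u = scale (coeff {#} ?u) 1"
    using monomial_expansion[of ?u] by simp
  then have "scale (inverse (coeff {#} ?u)) ?u = 1"
    using 0 by (metis scale_scale left_inverse scale_one)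
  moreover have "?u \<in> C" by (rule act_mem_subcoalgebra[OF linear_coeff C h(1)])
  ultimately show ?thesis
    using C subspace_scale by (metis subcoalgebra_def)
qed

text \<open>The line through 1 is a subcoalgebra contained in every nonzero one, hence the only
  simple one.\<close>

lemma coradical_eq: "coradical scale comult = span {1}"
proof -
  have D: "subcoalgebra scale comult (span {1})"
    unfolding subcoalgebra_def
  proof (intro conjI ballI subspace_span)
    fix h :: 'h assume "h \<in> span {1}"
    then obtain c where "h = scale c 1" by (auto simp: span_singleton)
    then have "free_scale c (tens 1 1) \<in> comult h" using comult_scale[OF comult_one] by simp
    moreover have "tens 1 1 \<in> {tens a b | a b. a \<in> span {1} \<and> b \<in> span {1 :: 'h}}"
      by (auto intro: span_base)
    then have "free_scale c (tens 1 1) \<in>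
        free_span {tens a b | a b. a \<in> span {1} \<and> b \<in> span {1 :: 'h}}"
      by (intro free.span_scale free.span_base)
    ultimately show "comult h \<in> tensor_span scale {tens a b | a b. a \<in> span {1} \<and> b \<in> span {1}}"
      by (rule comult_mem_tensor_spanI)
  qed
  have contains: "span {1} \<subseteq> C" if C: "subcoalgebra scale comult C" "C \<noteq> {0}" for C
  proof -
    have sub: "subspace C" using C by (simp add: subcoalgebra_def)
    then obtain h where "h \<in> C" "h \<noteq> 0" using C(2) subspace_0 by blast
    then have "1 \<in> C" using one_mem_subcoalgebra C(1) by blast
    then show ?thesis using sub by (intro span_minimal) auto
  qed
  have ne: "span {1 :: 'h} \<noteq> {0}" using span_base[of 1 "{1}"] by auto
  have "{C. simple_subcoalgebra scale comult C} = {span {1}}"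
  proof (intro equalityI subsetI)
    fix C assume "C \<in> {C. simple_subcoalgebra scale comult C}"
    then show "C \<in> {span {1}}"
      using contains[of C] D ne unfolding simple_subcoalgebra_def by auto
  next
    fix C assume "C \<in> {span {1 :: 'h}}"
    then show "C \<in> {C. simple_subcoalgebra scale comult C}"
      using contains D ne unfolding simple_subcoalgebra_def by auto
  qed
  then show ?thesis by (simp add: coradical_def)
qed

section \<open>Degree and the layers of the coradical filtration\<close>

lemma filtration_mono_Suc: "filtration m \<subseteq> filtration (Suc m)"
proof (induction m)
  case 0
  show ?case
  proof
    fix h assume "h \<in> filtration 0"
    then obtain c where "h = scale c 1" by (auto simp: coradical_eq span_singleton)
    then have "free_scale c (tens 1 1) \<in> comult h" using comult_scale[OF comult_one] by simp
    moreover have "tens 1 1 \<in> layer_tensors 0" by (auto simp: coradical_eq intro: span_base)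
    then have "free_scale c (tens 1 1) \<in> free_span (layer_tensors 0)"
      by (intro free.span_scale free.span_base)
    ultimately have "comult h \<in> tensor_span scale (layer_tensors 0)"
      by (rule comult_mem_tensor_spanI)
    then show "h \<in> filtration (Suc 0)" by simp
  qed
next
  case (Suc m)
  then have "layer_tensors m \<subseteq> layer_tensors (Suc m)" by blast
  then have "tensor_span scale (layer_tensors m) \<subseteq> tensor_span scale (layer_tensors (Suc m))"
    unfolding tensor_span_def by (intro image_mono free.span_mono)
  then have "{h. comult h \<in> tensor_span scale (layer_tensors m)} \<subseteq>
    {h. comult h \<in> tensor_span scale (layer_tensors (Suc m))}" by blast
  then show ?case by (simp only: coradical_filtration.simps)
qed

lemma filtration_mono: "m \<le> n \<Longrightarrow> filtration m \<subseteq> filtration n"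
  by (rule lift_Suc_mono_le[of filtration]) (rule filtration_mono_Suc)

lemma one_mem_coradical: "1 \<in> coradical scale comult"
  by (simp add: coradical_eq span_base)

text \<open>Leading and error terms merged, with multiplicities forgotten: the form suited to
  placing monomials in layers.\<close>

lemma comult_monomial:
  assumes "V \<in> monomials"
  obtains y where "y \<in> comult (monomial V)"
    and "y \<in> tensor_monomials {(A, B). A \<in> monomials \<and> B \<in> monomials \<and>
      deg A + deg B \<le> deg V \<and> (A + B < V \<or> A + B = V)}"
proof -
  let ?S = "{(A, B). A \<in> monomials \<and> B \<in> monomials \<and> deg A + deg B \<le> deg V \<and>
    (A + B < V \<or> A + B = V)}"
  define V' where "V' = sorted_list_of_multiset V"
  have V': "set V' \<subseteq> \<Xi>" "mset V' = V" "sorted V'" "monomial V = word_prod z V'"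
    using assms by (auto simp: V'_def monomials_def monomial_def)
  obtain y where y: "y \<in> comult (monomial V)"
    "y - sum_list (map tens_words (word_splits V')) \<in> tensor_monomials (lower V)"
    using comult_word_prod[OF V'(1)] V' by auto
  have "set (map tens_words (word_splits V')) \<subseteq> tensor_monomials ?S"
  proof clarsimp
    fix a b assume ab: "(a, b) \<in> set (word_splits V')"
    have sum: "mset a + mset b = V" using mset_word_splits[OF ab] V' by simp
    then have "mset a \<in> monomials" "mset b \<in> monomials" using assms by (metis monomials_simps(3))+
    moreover have "deg (mset a) + deg (mset b) = deg V" using sum by (metis deg_simps(3))
    moreover have "word_prod z a = monomial (mset a)" "word_prod z b = monomial (mset b)"
      using sorted_word_splits[OF ab] V' by (simp_all add: monomial_mset)
    ultimately show "tens (word_prod z a) (word_prod z b) \<in> tensor_monomials ?S"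
      unfolding tensor_monomials_def using sum
      by (intro free.span_base UnI1 image_eqI[of _ _ "(mset a, mset b)"]) auto
  qed
  then have "sum_list (map tens_words (word_splits V')) \<in> tensor_monomials ?S"
    by (rule subspace_sum_list[OF subspace_tensor_monomials])
  moreover have "y - sum_list (map tens_words (word_splits V')) \<in> tensor_monomials ?S"
    using y(2) by (rule tensor_monomials_mono[THEN subsetD, rotated]) (auto simp: lower_def)
  ultimately have "sum_list (map tens_words (word_splits V')) +
      (y - sum_list (map tens_words (word_splits V'))) \<in> tensor_monomials ?S"
    by (rule free.subspace_add[OF subspace_tensor_monomials])
  then have "y \<in> tensor_monomials ?S" by simp
  with y(1) show thesis by (rule that)
qed

lemma tensor_monomials_le_layer:
  assumes "\<And>A B. (A, B) \<in> S \<Longrightarrow> A = {#} \<or> monomial B \<in> filtration m"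
  shows "tensor_monomials S \<subseteq> free_span (layer_tensors m \<union> tensor_relations scale)"
  unfolding tensor_monomials_def
proof (intro free.span_mono Un_mono subset_refl image_subsetI)
  fix AB assume "AB \<in> S"
  then show "(case AB of (A, B) \<Rightarrow> tens (monomial A) (monomial B)) \<in> layer_tensors m"
    using assms[of "fst AB" "snd AB"] one_mem_coradical by (cases AB) auto
qed

text \<open>In each term of the coproduct either A is empty and the first factor 1 lies in the
  coradical, or A has degree at least 1 and B falls under the induction hypothesis.\<close>

lemma span_degree_le_filtration:
  assumes "\<And>x. x \<in> \<Xi> \<Longrightarrow> 1 \<le> d x"
  shows "span (monomial ` {M \<in> monomials. deg M \<le> n}) \<subseteq> filtration n"
proof -
  have deg_pos: "1 \<le> deg M" if "M \<in> monomials" "M \<noteq> {#}" for M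
    using that assms by (cases M) force+
  have "monomial M \<in> filtration n" if "M \<in> monomials" "deg M \<le> n" for M n
    using that
  proof (induction n arbitrary: M)
    case 0
    then have "M = {#}" using deg_pos by fastforce
    then show ?case by (simp add: one_mem_coradical)
  next
    case (Suc n)
    obtain y where y: "y \<in> comult (monomial M)"
      "y \<in> tensor_monomials {(A, B). A \<in> monomials \<and> B \<in> monomials \<and>
      deg A + deg B \<le> deg M \<and> (A + B < M \<or> A + B = M)}"
      using comult_monomial[OF Suc.prems(1)] by blast
    have "A = {#} \<or> monomial B \<in> filtration n"
      if "A \<in> monomials" "B \<in> monomials" "deg A + deg B \<le> deg M" for A B
      using that deg_pos[of A] Suc.prems Suc.IH[of B] by linarith
    then show ?case
      unfolding mem_filtration_Suc_iff[OF y(1)]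
      by (intro subsetD[OF tensor_monomials_le_layer y(2)]) blast
  qed
  then show ?thesis by (intro span_minimal subspace_filtration) auto
qed

lemma monomial_mem_filtration:
  assumes "V \<in> monomials"
  shows "\<exists>m. monomial V \<in> filtration m"
  using assms
proof (induction V rule: monomial_wf_induct)
  case (less V)
  let ?Z = "\<lambda>m. free_span (layer_tensors m \<union> tensor_relations scale)"
  obtain y where y: "y \<in> comult (monomial V)"
    and span: "y \<in> tensor_monomials {(A, B). A \<in> monomials \<and> B \<in> monomials \<and>
      deg A + deg B \<le> deg V \<and> (A + B < V \<or> A + B = V)}"
    using comult_monomial[OF less.hyps] by blast
  have Z_mono: "?Z m \<subseteq> ?Z n" if "m \<le> n" for m n
    using filtration_mono[OF that] by (intro free.span_mono Un_mono subset_refl) blast+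
  have "\<exists>m. y \<in> ?Z m"
    using span unfolding tensor_monomials_def
  proof (induction rule: free.span_induct_alt)
    case base
    show ?case using free.span_zero by blast
  next
    case (step c t y)
    from step(1) have "\<exists>m. t \<in> ?Z m"
    proof
      assume "t \<in> tensor_relations scale"
      then show ?thesis by (blast intro: free.span_base)
    next
      assume "t \<in> (\<lambda>(A, B). tens (monomial A) (monomial B)) ` {(A, B). A \<in> monomials \<and>
        B \<in> monomials \<and> deg A + deg B \<le> deg V \<and> (A + B < V \<or> A + B = V)}"
      then obtain A B where AB: "A \<in> monomials" "B \<in> monomials" "A + B < V \<or> A + B = V"
        and t: "t = tens (monomial A) (monomial B)" by auto
      show ?thesis
      proof (cases "A = {#}")
        case True
        then have "t \<in> layer_tensors 0" using t one_mem_coradical by auto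
        then show ?thesis by (blast intro: free.span_base)
      next
        case False
        then have "B < A + B" by simp
        then have "B < V" using AB(3) less_trans by metis
        then obtain m where "monomial B \<in> filtration m" using less.IH AB(2) by blast
        then have "t \<in> layer_tensors m" using t by blast
        then show ?thesis by (blast intro: free.span_base)
      qed
    qed
    with step(2) obtain m n where "t \<in> ?Z m" "y \<in> ?Z n" by blast
    then have "t \<in> ?Z (max m n)" "y \<in> ?Z (max m n)"
      using Z_mono[of m "max m n"] Z_mono[of n "max m n"] by auto
    then have "free_scale c t + y \<in> ?Z (max m n)" by (intro free.span_add free.span_scale)
    then show ?case by blast
  qed
  then obtain m where "monomial V \<in> filtration (Suc m)"
    unfolding mem_filtration_Suc_iff[OF y] by blast
  then show ?case by blast
qed

text \<open>The \<open>LEAST\<close> in \<open>d_H\<close> is attained because z x lies in some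
  layer; raising that layer by one secures 1 \<le> m.\<close>

lemma d_H_ge_1:
  assumes "x \<in> \<Xi>"
  shows "1 \<le> d_H scale comult z x"
proof -
  obtain m where "z x \<in> filtration m"
    using monomial_mem_filtration[of "{#x#}"] assms by auto
  then have "z x \<in> filtration (Suc m)" using filtration_mono_Suc by blast
  then have "1 \<le> Suc m \<and> z x \<in> filtration (Suc m)" by simp
  from LeastI[of "\<lambda>m. 1 \<le> m \<and> z x \<in> filtration m", OF this] show ?thesis
    by (simp add: d_H_def)
qed

text \<open>Strong induction: where the lower layers are known to be spans, the coordinate of a
  monomial vanishes on each such layer of index below its degree.\<close>

theorem filtration_eq_span:
  assumes minimal: "minimal_system scale comult \<Xi> z d"
    and d_ge_1: "\<And>x. x \<in> \<Xi> \<Longrightarrow> 1 \<le> d x"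
  shows "filtration n = span (monomial ` {M \<in> monomials. deg M \<le> n})"
proof (induction n rule: less_induct)
  case (less n)
  have deg_pos: "1 \<le> deg M" if "M \<in> monomials" "M \<noteq> {#}" for M
    using that d_ge_1 by (cases M) force+
  show ?case
  proof (intro equalityI span_degree_le_filtration[OF d_ge_1] subsetI)
    fix x assume x: "x \<in> filtration n"
    show "x \<in> span (monomial ` {M \<in> monomials. deg M \<le> n})"
    proof (cases n)
      case 0
      have "span {1} \<subseteq> span (monomial ` {M \<in> monomials. deg M \<le> n})"
        by (intro span_mono) (auto intro!: image_eqI[of _ _ "{#}"])
      then show ?thesis using x 0 by (auto simp: coradical_eq)
    next
      case (Suc k)
      show ?thesis
      proof (rule ccontr)
        assume "x \<notin> span (monomial ` {M \<in> monomials. deg M \<le> n})"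
        then have "\<not> support x \<subseteq> {M \<in> monomials. deg M \<le> n}" using span_if_support by blast
        then obtain W0 where "W0 \<in> support x" "W0 \<notin> {M \<in> monomials. deg M \<le> n}" by blast
        then have W0: "W0 \<in> support x" "n < deg W0" by (auto simp: support_def)
        define N where "N = Max (deg ` support x)"
        have deg_le_N: "deg W \<le> N" if "W \<in> support x" for W
          unfolding N_def using that finite_support by simp
        have "N > n" using W0 deg_le_N by fastforce
        have "N \<in> deg ` support x"
          unfolding N_def using W0 finite_support by (intro Max_in) auto
        define T where "T = {W \<in> support x. deg W = N}"
        have T: "finite T" "T \<noteq> {}" using finite_support \<open>N \<in> _\<close> by (auto simp: T_def)
        \<comment> \<open>The multiset order does not refine the degree, so the largest monomial is
          taken among those of top degree.\<close>
        define V where "V = Max T"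
        have "V \<in> T" unfolding V_def using T by (rule Max_in)
        then have V: "V \<in> support x" "deg V = N" "V \<in> monomials" by (auto simp: T_def support_def)
        have V_max: "W \<le> V" if "W \<in> support x" "deg W = N" for W
          unfolding V_def using T(1) that by (simp add: T_def)
        have "V \<noteq> {#}" using V(2) \<open>N > n\<close> by auto
        then obtain v Q where VQ: "V = add_mset v Q" by (meson multiset_cases)
        show False
        proof (cases "Q = {#}")
          case False
          have Q: "Q \<in> monomials" and P: "{#v#} \<in> monomials" using V(3) VQ by auto
          have "1 \<le> deg Q" using deg_pos[OF Q False] .
          have "1 \<le> d v" using d_ge_1 P by simp
          have nonzero: "coeff {#v#} (act (coeff Q) x) \<noteq> 0"
          proof (rule coeff_act_leading[OF V(1) P Q])
            fix W assume "W \<in> support x" "V \<le> W" "deg V \<le> deg W"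
            then show "W = V" using V_max[of W] deg_le_N[of W] V(2) by (auto intro: antisym)
          qed (simp add: VQ)
          \<comment> \<open>By induction, elements of layer j involve only monomials of degree at
            most j < d v, so they have no coordinate at v.\<close>
          have contraction: "act (coeff Q) x \<notin> filtration j" if "j < n" "j < d v" for j
            using nonzero coeff_eq_0_if_span[of "act (coeff Q) x" "{M \<in> monomials. deg M \<le> j}" "{#v#}"]
              less.IH[OF that(1)] that(2) P by auto
          have coeff_Q: "coeff Q h = 0" if "h \<in> filtration j" "j < n" "j < deg Q" for h j
            using coeff_eq_0_if_span[of h "{M \<in> monomials. deg M \<le> j}" Q]
              less.IH[OF that(2)] that Q by auto
          have degs: "d v + deg Q = N" using V(2) VQ by simp
          show False
          proof (cases "deg Q \<le> n")
            case True
            \<comment> \<open>The coordinate of \<open>Q\<close> vanishes on layer deg Q - 1, so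
              contraction lowers layer n by deg Q; and n - deg Q < N - deg Q = d v.\<close>
            define q where "q = deg Q - 1"
            have q: "deg Q = Suc q" "n = Suc q + (n - deg Q)" using \<open>1 \<le> deg Q\<close> True by (auto simp: q_def)
            have "act (coeff Q) x \<in> filtration (n - deg Q)"
              by (rule act_mem_filtration[OF linear_coeff, of q]) (use coeff_Q q x in auto)
            then show False using contraction[of "n - deg Q"] degs \<open>N > n\<close> \<open>1 \<le> deg Q\<close> True by auto
          next
            case False
            \<comment> \<open>The induction reaches only up to layer k = n - 1. The coordinate of
              \<open>Q\<close> vanishes there, so the contraction falls into the coradical.\<close>
            have "act (coeff Q) x \<in> filtration 0"
              by (rule act_mem_filtration[OF linear_coeff, of k]) (use coeff_Q False Suc x in auto)
            then show False using contraction[of 0] \<open>1 \<le> d v\<close> Suc by auto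
          qed
        next
          case True
          then have Vv: "V = {#v#}" and v: "v \<in> \<Xi>" and dv: "d v = N" using VQ V by auto
          define c where "c = coeff V x"
          have c: "c \<noteq> 0" using V(1) by (simp add: c_def support_def)
          \<comment> \<open>The top degree part of \<open>x\<close> is
            \<open>scale c (z v + h)\<close>. Its largest monomial is the letter v, so the others
            use only letters below v, which puts \<open>h\<close> into
            \<open>H_plus\<close>.\<close>
          define h where "h = (\<Sum>W\<in>T - {V}. scale (coeff W x / c) (monomial W))"
          define u where "u = (\<Sum>W\<in>support x - T. scale (coeff W x) (monomial W))"
          have "x = u + (\<Sum>W\<in>T. scale (coeff W x) (monomial W))"
            unfolding u_def
            by (subst monomial_expansion, rule sum.subset_diff[OF _ finite_support]) (auto simp: T_def)
          also have "(\<Sum>W\<in>T. scale (coeff W x) (monomial W)) =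
              scale c (monomial V) + (\<Sum>W\<in>T - {V}. scale (coeff W x) (monomial W))"
            using sum.remove[OF T(1) \<open>V \<in> T\<close>] by (simp add: c_def)
          also have "\<dots> = scale c (z v + h)"
            using c by (simp add: h_def Vv scale_right_distrib scale_sum_right)
          finally have "scale c (z v + h) = x - u" by simp
          then have zh: "z v + h = scale (inverse c) (x - u)"
            using c by (metis left_inverse scale_one scale_scale)
          have "u \<in> span (monomial ` {M \<in> monomials. deg M \<le> N - 1})"
            unfolding u_def
          proof (intro span_sum span_scale span_base imageI)
            fix W assume W: "W \<in> support x - T"
            then have "deg W \<noteq> N" "deg W \<le> N" using deg_le_N by (auto simp: T_def)
            then show "W \<in> {M \<in> monomials. deg M \<le> N - 1}" using W by (auto simp: support_def)
          qed
          \<comment> \<open>The part of \<open>x\<close> of lower degree lies in layer N - 1 by the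
            easy inclusion, and so does \<open>x\<close> because n < N. Hence so does
            \<open>z v + h\<close>, against minimality, as d v = N.\<close>
          then have "u \<in> filtration (N - 1)" using span_degree_le_filtration[OF d_ge_1] by blast
          moreover have "n \<le> N - 1" using \<open>N > n\<close> by simp
          then have "x \<in> filtration (N - 1)" using x filtration_mono by blast
          ultimately have "z v + h \<in> filtration (N - 1)"
            unfolding zh by (intro subspace_scale subspace_diff subspace_filtration)
          moreover have "h \<in> H_plus scale \<Xi> z v d"
            unfolding H_plus_def h_def
          proof (intro span_sum span_scale span_base CollectI)
            fix W assume W: "W \<in> T - {V}"
            let ?W = "sorted_list_of_multiset W"
            have "W < V" using W V_max by (auto simp: T_def le_less)
            then have "a < v" if "a \<in># W" for a using that Vv by simp
            \<comment> \<open>\<open>H_plus\<close> admits nonempty words only; N > n rules out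
              degree 0.\<close>
            moreover have "W \<noteq> {#}" using W \<open>N > n\<close> by (auto simp: T_def)
            then have "?W \<noteq> []" by (metis mset.simps(1) mset_sorted_list_of_multiset)
            ultimately have "less_rlex ?W [v]"
              unfolding less_rlex_def by (intro disjI2 less_r_singletonI) auto
            moreover have "?W \<in> nondecreasing_words_plus \<Xi>"
              using W \<open>?W \<noteq> []\<close>
              by (auto simp: nondecreasing_words_plus_def nondecreasing_words_def T_def support_def
                  monomials_def)
            moreover have "word_degree d ?W \<le> d v"
              using W by (simp add: word_degree_eq T_def dv)
            ultimately show "\<exists>W'. monomial W = word_prod z W' \<and> W' \<in> nondecreasing_words_plus \<Xi> \<and>
                word_degree d W' \<le> d v \<and> less_rlex W' [v]"
              by (intro exI[of _ ?W]) (simp add: monomial_def)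
          qed
          ultimately show False
            using minimal v unfolding minimal_system_def dv[symmetric] by blast
        qed
      qed
    qed
  qed
qed

end

theorem proposition5p15:
  fixes scale :: "'k::field_char_0 \<Rightarrow> 'h::ring_1 \<Rightarrow> 'h"
    and comult :: "'h \<Rightarrow> ('h \<times> 'h \<Rightarrow>\<^sub>0 'k) set"
    and counit :: "'h \<Rightarrow> 'k"
    and antipode :: "'h \<Rightarrow> 'h"
    and \<Xi> :: "'i::linorder set"
    and z :: "'i \<Rightarrow> 'h"
    and m :: nat
  assumes "hopf_algebra scale comult counit antipode"
    and "finite \<Xi>"
    and "PBW_generating_system scale \<Xi> z"
    and "minimal_system scale comult \<Xi> z (d_H scale comult z)"
    and "triangular_system scale \<Xi> z (d_H scale comult z)"
    and "dominated_system scale comult \<Xi> z (d_H scale comult z)"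
  shows "coradical_filtration scale comult m =
    module.span scale {word_prod z V | V. V \<in> nondecreasing_words \<Xi> \<and>
      word_degree (d_H scale comult z) V \<le> m}"
proof -
  interpret hopf_algebra scale comult counit antipode by fact
  interpret dominated_PBW_system scale comult counit antipode \<Xi> z "d_H scale comult z"
    by unfold_locales fact+
  have "{word_prod z V | V. V \<in> nondecreasing_words \<Xi> \<and> word_degree (d_H scale comult z) V \<le> m} =
      monomial ` {M \<in> monomials. deg M \<le> m}"
    unfolding word_degree_eq word_prod_nondecreasing_words[symmetric] by blast
  then show ?thesis using filtration_eq_span[OF assms(4) d_H_ge_1] by simp
qed

end
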